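(* Let $\mathcal{H}:\mathsf{M}\to\mathsf{N}$ be a functor with right adjoint $\mathcal{K}$, unit $\eta$ and counit $\xi$, and let $(\mathcal{C},\delta,\epsilon)$ be a comonad on $\mathsf{M}$, with conjugate comonad $\mathcal{C}^{\vee}=\mathcal{H}\mathcal{C}\mathcal{K}$ on $\mathsf{N}$. Assume: (a) any parallel pair in $\mathsf{M}$ which is coreflexive and $\mathcal{H}$-split has an equalizer in $\mathsf{M}$; (b) $\mathcal{H}$ preserves the equalizer of any such pair; (c) $\mathcal{H}$ is conservative; (d) $\mathcal{C}$ and $\mathcal{C}^2$ preserve the equalizer of any parallel pair in $\mathsf{M}$ which is both coreflexive and $\mathcal{H}$-split. Then the adjunction $$\mathcal{H}_{\gamma}:\mathsf{M}_{\mathcal{C}}\rightleftarrows\mathsf{N}_{\mathcal{C}^{\vee}}:\mathcal{K}^{\overline{\gamma}}$$ is an adjoint equivalence.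
   Context: A functor is conservative if it reflects isomorphisms. A parallel pair $f,g:X\rightrightarrows Y$ is coreflexive if there is $r:Y\to X$ with $rf=\mathrm{id}=rg$. A split cofork is a diagram $E\xrightarrow{e}X\rightrightarrows Y$ (parallel arrows $f,g$) with $fe=ge$ for which there exist $p:X\to E$ and $q:Y\to X$ with $pe=\mathrm{id}$, $qf=\mathrm{id}$, $ep=qg$. A parallel pair is $\mathcal{H}$-split if its image under $\mathcal{H}$ is part of a split cofork. $\mathsf{M}_{\mathcal{C}}$ denotes the category of $\mathcal{C}$-coalgebras. The conjugate comonad $\mathcal{C}^{\vee}=\mathcal{H}\mathcal{C}\mathcal{K}$ has comultiplication $(\mathcal{H}\mathcal{C}\eta\mathcal{C}\mathcal{K})\circ(\mathcal{H}\delta\mathcal{K})$ and counit $\xi\circ(\mathcal{H}\epsilon\mathcal{K})$. Define $\gamma=\mathcal{H}\mathcal{C}\eta:\mathcal{H}\mathcal{C}\to\mathcal{H}\mathcal{C}\mathcal{K}\mathcal{H}=\mathcal{C}^{\vee}\mathcal{H}$ and $\overline{\gamma}=\eta\mathcal{C}\mathcal{K}:\mathcal{C}\mathcal{K}\to\mathcal{K}\mathcal{H}\mathcal{C}\mathcal{K}=\mathcal{K}\mathcal{C}^{\vee}$. The functor $\mathcal{H}_\gamma$ sends $(M,c)$ to $(\mathcal{H}(M),\gamma_M\circ\mathcal{H}(c))$ and acts as $\mathcal{H}$ on morphisms. For a $\mathcal{C}^{\vee}$-coalgebra $(N,d)$, $\mathcal{K}^{\overline{\gamma}}(N,d)$ is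 the equalizer in $\mathsf{M}_{\mathcal{C}}$ of the pair of morphisms of (cofree) $\mathcal{C}$-coalgebras $$\mathcal{C}\mathcal{K}(N)\xrightarrow{\delta_{\mathcal{K}(N)}}\mathcal{C}\mathcal{C}\mathcal{K}(N)\xrightarrow{\mathcal{C}(\overline{\gamma}_N)}\mathcal{C}\mathcal{K}\mathcal{C}^{\vee}(N)\quad\text{and}\quad\mathcal{C}\mathcal{K}(N)\xrightarrow{\mathcal{C}\mathcal{K}(d)}\mathcal{C}\mathcal{K}\mathcal{C}^{\vee}(N);$$ under hypotheses (a) and (d) these equalizers exist. The unit $\hat\eta_{(M,c)}:(M,c)\to\mathcal{K}^{\overline\gamma}\mathcal{H}_\gamma(M,c)$ of the adjunction is the unique coalgebra morphism whose composite with the canonical map to $\mathcal{C}\mathcal{K}\mathcal{H}(M)$ is $\mathcal{C}(\eta_M)\circ c$; the counit at $(N,d)$ is the composite of $\mathcal{H}$ of the canonical map $\mathcal{K}^{\overline\gamma}(N,d)\to\mathcal{C}\mathcal{K}(N)$ with $\mathcal{H}(\epsilon_{\mathcal{K}(N)})$ and $\xi_N$. *)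

theory Defs
  imports Main
begin

section \<open>Categories, functors, natural transformations\<close>

text \<open>The fields are only meaningful on \<open>Obj\<close> and \<open>Arr\<close>, and composition only on
  composable pairs; all predicates below are relativised accordingly.\<close>

record ('o, 'a) cat =
  Obj :: "'o set"
  Arr :: "'a set"
  Dom :: "'a \<Rightarrow> 'o"
  Cod :: "'a \<Rightarrow> 'o"
  Ident :: "'o \<Rightarrow> 'a"
  Comp :: "'a \<Rightarrow> 'a \<Rightarrow> 'a"  (infixr "\<cdot>\<index>" 70)

definition hom :: "('o, 'a) cat \<Rightarrow> 'o \<Rightarrow> 'o \<Rightarrow> 'a set" where
  "hom A X Y = {f \<in> Arr A. Dom A f = X \<and> Cod A f = Y}"

locale category =
  fixes A :: "('o, 'a) cat" (structure)
  assumes Dom_Obj: "f \<in> Arr A \<Longrightarrow> Dom A f \<in> Obj A"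
    and Cod_Obj: "f \<in> Arr A \<Longrightarrow> Cod A f \<in> Obj A"
    and Ident_hom: "X \<in> Obj A \<Longrightarrow> Ident A X \<in> hom A X X"
    and Comp_hom: "f \<in> hom A X Y \<Longrightarrow> g \<in> hom A Y Z \<Longrightarrow> g \<cdot> f \<in> hom A X Z"
    and Ident_left: "f \<in> hom A X Y \<Longrightarrow> Ident A Y \<cdot> f = f"
    and Ident_right: "f \<in> hom A X Y \<Longrightarrow> f \<cdot> Ident A X = f"
    and Comp_assoc: "f \<in> hom A W X \<Longrightarrow> g \<in> hom A X Y \<Longrightarrow> h \<in> hom A Y Z
                       \<Longrightarrow> (h \<cdot> g) \<cdot> f = h \<cdot> (g \<cdot> f)"

definition iso :: "('o, 'a) cat \<Rightarrow> 'a \<Rightarrow> bool" where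
  "iso A f \<longleftrightarrow> f \<in> Arr A \<and>
     (\<exists>g \<in> hom A (Cod A f) (Dom A f).
        g \<cdot>\<^bsub>A\<^esub> f = Ident A (Dom A f) \<and> f \<cdot>\<^bsub>A\<^esub> g = Ident A (Cod A f))"

record ('o, 'a, 'p, 'b) ftor =
  omap :: "'o \<Rightarrow> 'p"
  amap :: "'a \<Rightarrow> 'b"

definition is_functor ::
  "('o, 'a) cat \<Rightarrow> ('p, 'b) cat \<Rightarrow> ('o, 'a, 'p, 'b) ftor \<Rightarrow> bool" where
  "is_functor A B F \<longleftrightarrow> category A \<and> category B \<and>
     (\<forall>X \<in> Obj A. omap F X \<in> Obj B) \<and>
     (\<forall>f \<in> Arr A. amap F f \<in> hom B (omap F (Dom A f)) (omap F (Cod A f))) \<and>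
     (\<forall>X \<in> Obj A. amap F (Ident A X) = Ident B (omap F X)) \<and>
     (\<forall>f \<in> Arr A. \<forall>g \<in> Arr A. Dom A g = Cod A f \<longrightarrow>
        amap F (g \<cdot>\<^bsub>A\<^esub> f) = amap F g \<cdot>\<^bsub>B\<^esub> amap F f)"

definition id_ftor :: "('o, 'a, 'o, 'a) ftor" where
  "id_ftor = \<lparr>omap = (\<lambda>X. X), amap = (\<lambda>f. f)\<rparr>"

definition comp_ftor ::
  "('p, 'b, 'q, 'c) ftor \<Rightarrow> ('o, 'a, 'p, 'b) ftor \<Rightarrow> ('o, 'a, 'q, 'c) ftor"
  (infixr "\<circ>\<^sub>F" 75) where
  "G \<circ>\<^sub>F F = \<lparr>omap = (\<lambda>X. omap G (omap F X)), amap = (\<lambda>f. amap G (amap F f))\<rparr>"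

definition nat_trans ::
  "('o, 'a) cat \<Rightarrow> ('p, 'b) cat \<Rightarrow> ('o, 'a, 'p, 'b) ftor \<Rightarrow> ('o, 'a, 'p, 'b) ftor
     \<Rightarrow> ('o \<Rightarrow> 'b) \<Rightarrow> bool" where
  "nat_trans A B F G \<tau> \<longleftrightarrow> is_functor A B F \<and> is_functor A B G \<and>
     (\<forall>X \<in> Obj A. \<tau> X \<in> hom B (omap F X) (omap G X)) \<and>
     (\<forall>f \<in> Arr A. \<tau> (Cod A f) \<cdot>\<^bsub>B\<^esub> amap F f = amap G f \<cdot>\<^bsub>B\<^esub> \<tau> (Dom A f))"

definition conservative ::
  "('o, 'a) cat \<Rightarrow> ('p, 'b) cat \<Rightarrow> ('o, 'a, 'p, 'b) ftor \<Rightarrow> bool" where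
  "conservative A B F \<longleftrightarrow> (\<forall>f \<in> Arr A. iso B (amap F f) \<longrightarrow> iso A f)"

section \<open>Adjunctions\<close>

definition adjunction ::
  "('o, 'a) cat \<Rightarrow> ('p, 'b) cat \<Rightarrow> ('o, 'a, 'p, 'b) ftor \<Rightarrow> ('p, 'b, 'o, 'a) ftor
     \<Rightarrow> ('o \<Rightarrow> 'a) \<Rightarrow> ('p \<Rightarrow> 'b) \<Rightarrow> bool" where
  "adjunction A B L R \<eta> \<xi> \<longleftrightarrow> is_functor A B L \<and> is_functor B A R \<and>
     nat_trans A A id_ftor (R \<circ>\<^sub>F L) \<eta> \<and>
     nat_trans B B (L \<circ>\<^sub>F R) id_ftor \<xi> \<and>
     (\<forall>X \<in> Obj A. \<xi> (omap L X) \<cdot>\<^bsub>B\<^esub> amap L (\<eta> X) = Ident B (omap L X)) \<and>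
     (\<forall>Y \<in> Obj B. amap R (\<xi> Y) \<cdot>\<^bsub>A\<^esub> \<eta> (omap R Y) = Ident A (omap R Y))"

definition adjoint_equivalence ::
  "('o, 'a) cat \<Rightarrow> ('p, 'b) cat \<Rightarrow> ('o, 'a, 'p, 'b) ftor \<Rightarrow> ('p, 'b, 'o, 'a) ftor
     \<Rightarrow> ('o \<Rightarrow> 'a) \<Rightarrow> ('p \<Rightarrow> 'b) \<Rightarrow> bool" where
  "adjoint_equivalence A B L R \<eta> \<xi> \<longleftrightarrow> adjunction A B L R \<eta> \<xi> \<and>
     (\<forall>X \<in> Obj A. iso A (\<eta> X)) \<and> (\<forall>Y \<in> Obj B. iso B (\<xi> Y))"

section \<open>Equalizers and split coforks\<close>

definition parallel :: "('o, 'a) cat \<Rightarrow> 'a \<Rightarrow> 'a \<Rightarrow> bool" where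
  "parallel A f g \<longleftrightarrow> f \<in> Arr A \<and> g \<in> Arr A \<and> Dom A f = Dom A g \<and> Cod A f = Cod A g"

text \<open>An equalizer is given by its canonical arrow \<open>e\<close>; the object is \<open>Dom A e\<close>.\<close>

definition equalizer :: "('o, 'a) cat \<Rightarrow> 'a \<Rightarrow> 'a \<Rightarrow> 'a \<Rightarrow> bool" where
  "equalizer A f g e \<longleftrightarrow> parallel A f g \<and> e \<in> Arr A \<and> Cod A e = Dom A f \<and>
     f \<cdot>\<^bsub>A\<^esub> e = g \<cdot>\<^bsub>A\<^esub> e \<and>
     (\<forall>h \<in> Arr A. Cod A h = Dom A f \<and> f \<cdot>\<^bsub>A\<^esub> h = g \<cdot>\<^bsub>A\<^esub> h \<longrightarrow>
        (\<exists>!u. u \<in> hom A (Dom A h) (Dom A e) \<and> e \<cdot>\<^bsub>A\<^esub> u = h))"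

definition coreflexive :: "('o, 'a) cat \<Rightarrow> 'a \<Rightarrow> 'a \<Rightarrow> bool" where
  "coreflexive A f g \<longleftrightarrow> parallel A f g \<and>
     (\<exists>r \<in> hom A (Cod A f) (Dom A f).
        r \<cdot>\<^bsub>A\<^esub> f = Ident A (Dom A f) \<and> r \<cdot>\<^bsub>A\<^esub> g = Ident A (Dom A f))"

definition split_cofork :: "('o, 'a) cat \<Rightarrow> 'a \<Rightarrow> 'a \<Rightarrow> 'a \<Rightarrow> bool" where
  "split_cofork A e f g \<longleftrightarrow> parallel A f g \<and> e \<in> Arr A \<and> Cod A e = Dom A f \<and>
     f \<cdot>\<^bsub>A\<^esub> e = g \<cdot>\<^bsub>A\<^esub> e \<and>
     (\<exists>p \<in> hom A (Dom A f) (Dom A e). \<exists>q \<in> hom A (Cod A f) (Dom A f).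
        p \<cdot>\<^bsub>A\<^esub> e = Ident A (Dom A e) \<and> q \<cdot>\<^bsub>A\<^esub> f = Ident A (Dom A f) \<and>
        e \<cdot>\<^bsub>A\<^esub> p = q \<cdot>\<^bsub>A\<^esub> g)"

definition split_under ::
  "('o, 'a) cat \<Rightarrow> ('p, 'b) cat \<Rightarrow> ('o, 'a, 'p, 'b) ftor \<Rightarrow> 'a \<Rightarrow> 'a \<Rightarrow> bool" where
  "split_under A B F f g \<longleftrightarrow> parallel A f g \<and> (\<exists>e. split_cofork B e (amap F f) (amap F g))"

definition preserves_equalizer ::
  "('o, 'a) cat \<Rightarrow> ('p, 'b) cat \<Rightarrow> ('o, 'a, 'p, 'b) ftor \<Rightarrow> 'a \<Rightarrow> 'a \<Rightarrow> bool" where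
  "preserves_equalizer A B F f g \<longleftrightarrow>
     (\<forall>e. equalizer A f g e \<longrightarrow> equalizer B (amap F f) (amap F g) (amap F e))"

section \<open>Comonads and coalgebras\<close>

record ('o, 'a) comonad_data =
  endo :: "('o, 'a, 'o, 'a) ftor"
  comult :: "'o \<Rightarrow> 'a"
  coun :: "'o \<Rightarrow> 'a"

definition comonad :: "('o, 'a) cat \<Rightarrow> ('o, 'a) comonad_data \<Rightarrow> bool" where
  "comonad A C \<longleftrightarrow> is_functor A A (endo C) \<and>
     nat_trans A A (endo C) (endo C \<circ>\<^sub>F endo C) (comult C) \<and>
     nat_trans A A (endo C) id_ftor (coun C) \<and>
     (\<forall>X \<in> Obj A.
        comult C (omap (endo C) X) \<cdot>\<^bsub>A\<^esub> comult C X = amap (endo C) (comult C X) \<cdot>\<^bsub>A\<^esub> comult C X \<and>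
        coun C (omap (endo C) X) \<cdot>\<^bsub>A\<^esub> comult C X = Ident A (omap (endo C) X) \<and>
        amap (endo C) (coun C X) \<cdot>\<^bsub>A\<^esub> comult C X = Ident A (omap (endo C) X))"

definition coalgebras :: "('o, 'a) cat \<Rightarrow> ('o, 'a) comonad_data \<Rightarrow> ('o \<times> 'a) set" where
  "coalgebras A C = {(X, c). X \<in> Obj A \<and> c \<in> hom A X (omap (endo C) X) \<and>
     comult C X \<cdot>\<^bsub>A\<^esub> c = amap (endo C) c \<cdot>\<^bsub>A\<^esub> c \<and>
     coun C X \<cdot>\<^bsub>A\<^esub> c = Ident A X}"

text \<open>An arrow of the category of coalgebras is a triple (source, underlying arrow, target),
  so that source and target coalgebra are determined by the arrow.\<close>

type_synonym ('o, 'a) coalg_arr = "('o \<times> 'a) \<times> 'a \<times> ('o \<times> 'a)"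

definition coalg_cat ::
  "('o, 'a) cat \<Rightarrow> ('o, 'a) comonad_data \<Rightarrow> ('o \<times> 'a, ('o, 'a) coalg_arr) cat" where
  "coalg_cat A C = \<lparr>
     Obj = coalgebras A C,
     Arr = {(S, f, T). S \<in> coalgebras A C \<and> T \<in> coalgebras A C \<and> f \<in> hom A (fst S) (fst T) \<and>
              snd T \<cdot>\<^bsub>A\<^esub> f = amap (endo C) f \<cdot>\<^bsub>A\<^esub> snd S},
     Dom = (\<lambda>(S, f, T). S),
     Cod = (\<lambda>(S, f, T). T),
     Ident = (\<lambda>S. (S, Ident A (fst S), S)),
     Comp = (\<lambda>(S', g, T') (S, f, T). (S, g \<cdot>\<^bsub>A\<^esub> f, T'))\<rparr>"

definition und :: "('o, 'a) coalg_arr \<Rightarrow> 'a" where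
  "und a = fst (snd a)"

definition cofree :: "('o, 'a) comonad_data \<Rightarrow> 'o \<Rightarrow> 'o \<times> 'a" where
  "cofree C X = (omap (endo C) X, comult C X)"

section \<open>The conjugate comonad and the lifted adjunction\<close>

definition conj_comonad ::
  "('p, 'b) cat \<Rightarrow> ('o, 'a, 'p, 'b) ftor \<Rightarrow> ('p, 'b, 'o, 'a) ftor \<Rightarrow> ('o \<Rightarrow> 'a) \<Rightarrow> ('p \<Rightarrow> 'b)
     \<Rightarrow> ('o, 'a) comonad_data \<Rightarrow> ('p, 'b) comonad_data" where
  "conj_comonad B H K \<eta> \<xi> C = \<lparr>
     endo = H \<circ>\<^sub>F endo C \<circ>\<^sub>F K,
     comult = (\<lambda>Y. amap H (amap (endo C) (\<eta> (omap (endo C) (omap K Y))))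
                     \<cdot>\<^bsub>B\<^esub> amap H (comult C (omap K Y))),
     coun = (\<lambda>Y. \<xi> Y \<cdot>\<^bsub>B\<^esub> amap H (coun C (omap K Y)))\<rparr>"

definition gam ::
  "('o, 'a, 'p, 'b) ftor \<Rightarrow> ('o \<Rightarrow> 'a) \<Rightarrow> ('o, 'a) comonad_data \<Rightarrow> 'o \<Rightarrow> 'b" where
  "gam H \<eta> C X = amap H (amap (endo C) (\<eta> X))"

definition gam_bar ::
  "('p, 'b, 'o, 'a) ftor \<Rightarrow> ('o \<Rightarrow> 'a) \<Rightarrow> ('o, 'a) comonad_data \<Rightarrow> 'p \<Rightarrow> 'a" where
  "gam_bar K \<eta> C Y = \<eta> (omap (endo C) (omap K Y))"

definition H_gam_obj ::
  "('p, 'b) cat \<Rightarrow> ('o, 'a, 'p, 'b) ftor \<Rightarrow> ('o \<Rightarrow> 'a) \<Rightarrow> ('o, 'a) comonad_data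
     \<Rightarrow> 'o \<times> 'a \<Rightarrow> 'p \<times> 'b" where
  "H_gam_obj B H \<eta> C S = (omap H (fst S), gam H \<eta> C (fst S) \<cdot>\<^bsub>B\<^esub> amap H (snd S))"

definition H_gam ::
  "('p, 'b) cat \<Rightarrow> ('o, 'a, 'p, 'b) ftor \<Rightarrow> ('o \<Rightarrow> 'a) \<Rightarrow> ('o, 'a) comonad_data
     \<Rightarrow> ('o \<times> 'a, ('o, 'a) coalg_arr, 'p \<times> 'b, ('p, 'b) coalg_arr) ftor" where
  "H_gam B H \<eta> C = \<lparr>
     omap = H_gam_obj B H \<eta> C,
     amap = (\<lambda>(S, f, T). (H_gam_obj B H \<eta> C S, amap H f, H_gam_obj B H \<eta> C T))\<rparr>"

text \<open>The pair of arrows between cofree coalgebras whose equalizer is the right adjoint at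
  \<open>(Y, d)\<close>. In these definitions \<open>H \<circ>\<^sub>F endo C \<circ>\<^sub>F K\<close> is the endofunctor of the conjugate
  comonad.\<close>

definition pair_fst ::
  "('o, 'a) cat \<Rightarrow> ('o, 'a, 'p, 'b) ftor \<Rightarrow> ('p, 'b, 'o, 'a) ftor \<Rightarrow> ('o \<Rightarrow> 'a)
     \<Rightarrow> ('o, 'a) comonad_data \<Rightarrow> 'p \<times> 'b \<Rightarrow> ('o, 'a) coalg_arr" where
  "pair_fst A H K \<eta> C D =
     (cofree C (omap K (fst D)),
      amap (endo C) (gam_bar K \<eta> C (fst D)) \<cdot>\<^bsub>A\<^esub> comult C (omap K (fst D)),
      cofree C (omap K (omap (H \<circ>\<^sub>F endo C \<circ>\<^sub>F K) (fst D))))"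

definition pair_snd ::
  "('o, 'a, 'p, 'b) ftor \<Rightarrow> ('p, 'b, 'o, 'a) ftor
     \<Rightarrow> ('o, 'a) comonad_data \<Rightarrow> 'p \<times> 'b \<Rightarrow> ('o, 'a) coalg_arr" where
  "pair_snd H K C D =
     (cofree C (omap K (fst D)),
      amap (endo C) (amap K (snd D)),
      cofree C (omap K (omap (H \<circ>\<^sub>F endo C \<circ>\<^sub>F K) (fst D))))"

text \<open>In the definitions below \<open>\<kappa>\<close> is a choice of equalizers in the category of coalgebras:
  \<open>\<kappa> D\<close> is the canonical arrow into the cofree coalgebra on \<open>omap K (fst D)\<close>. The action of the
  right adjoint on arrows is the one induced by the universal property of these equalizers.\<close>

definition equalizer_choice ::
  "('o, 'a) cat \<Rightarrow> ('p, 'b) cat \<Rightarrow> ('o, 'a, 'p, 'b) ftor \<Rightarrow> ('p, 'b, 'o, 'a) ftor \<Rightarrow> ('o \<Rightarrow> 'a)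
     \<Rightarrow> ('p \<Rightarrow> 'b) \<Rightarrow> ('o, 'a) comonad_data \<Rightarrow> ('p \<times> 'b \<Rightarrow> ('o, 'a) coalg_arr) \<Rightarrow> bool" where
  "equalizer_choice A B H K \<eta> \<xi> C \<kappa> \<longleftrightarrow>
     (\<forall>D \<in> coalgebras B (conj_comonad B H K \<eta> \<xi> C).
        equalizer (coalg_cat A C) (pair_fst A H K \<eta> C D) (pair_snd H K C D) (\<kappa> D))"

definition K_gam_obj ::
  "('o, 'a) cat \<Rightarrow> ('o, 'a) comonad_data \<Rightarrow> ('p \<times> 'b \<Rightarrow> ('o, 'a) coalg_arr)
     \<Rightarrow> 'p \<times> 'b \<Rightarrow> 'o \<times> 'a" where
  "K_gam_obj A C \<kappa> D = Dom (coalg_cat A C) (\<kappa> D)"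

definition K_gam ::
  "('o, 'a) cat \<Rightarrow> ('p, 'b, 'o, 'a) ftor \<Rightarrow> ('o, 'a) comonad_data
     \<Rightarrow> ('p \<times> 'b \<Rightarrow> ('o, 'a) coalg_arr)
     \<Rightarrow> ('p \<times> 'b, ('p, 'b) coalg_arr, 'o \<times> 'a, ('o, 'a) coalg_arr) ftor" where
  "K_gam A K C \<kappa> = \<lparr>
     omap = K_gam_obj A C \<kappa>,
     amap = (\<lambda>(D, g, D'). THE u.
       u \<in> hom (coalg_cat A C) (K_gam_obj A C \<kappa> D) (K_gam_obj A C \<kappa> D') \<and>
       \<kappa> D' \<cdot>\<^bsub>coalg_cat A C\<^esub> u =
         (cofree C (omap K (fst D)), amap (endo C) (amap K g), cofree C (omap K (fst D')))
           \<cdot>\<^bsub>coalg_cat A C\<^esub> \<kappa> D)\<rparr>"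

definition unit_hat ::
  "('o, 'a) cat \<Rightarrow> ('p, 'b) cat \<Rightarrow> ('o, 'a, 'p, 'b) ftor \<Rightarrow> ('p, 'b, 'o, 'a) ftor \<Rightarrow> ('o \<Rightarrow> 'a)
     \<Rightarrow> ('o, 'a) comonad_data \<Rightarrow> ('p \<times> 'b \<Rightarrow> ('o, 'a) coalg_arr)
     \<Rightarrow> 'o \<times> 'a \<Rightarrow> ('o, 'a) coalg_arr" where
  "unit_hat A B H K \<eta> C \<kappa> S = (THE u.
     u \<in> hom (coalg_cat A C) S (K_gam_obj A C \<kappa> (H_gam_obj B H \<eta> C S)) \<and>
     \<kappa> (H_gam_obj B H \<eta> C S) \<cdot>\<^bsub>coalg_cat A C\<^esub> u =
       (S, amap (endo C) (\<eta> (fst S)) \<cdot>\<^bsub>A\<^esub> snd S, cofree C (omap K (omap H (fst S)))))"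

definition counit_hat ::
  "('o, 'a) cat \<Rightarrow> ('p, 'b) cat \<Rightarrow> ('o, 'a, 'p, 'b) ftor \<Rightarrow> ('p, 'b, 'o, 'a) ftor \<Rightarrow> ('o \<Rightarrow> 'a)
     \<Rightarrow> ('p \<Rightarrow> 'b) \<Rightarrow> ('o, 'a) comonad_data \<Rightarrow> ('p \<times> 'b \<Rightarrow> ('o, 'a) coalg_arr)
     \<Rightarrow> 'p \<times> 'b \<Rightarrow> ('p, 'b) coalg_arr" where
  "counit_hat A B H K \<eta> \<xi> C \<kappa> D =
     (H_gam_obj B H \<eta> C (K_gam_obj A C \<kappa> D),
      \<xi> (fst D) \<cdot>\<^bsub>B\<^esub> amap H (coun C (omap K (fst D))) \<cdot>\<^bsub>B\<^esub> amap H (und (\<kappa> D)),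
      D)"

end

theory Submission
  imports Defs
begin

text \<open>
  Write \<open>\<epsilon>\<^sup>v\<close> and \<open>\<delta>\<^sup>v\<close> for the counit and the comultiplication of the conjugate comonad
  \<open>H C K\<close>. The proof is a comonadicity argument in the style of Beck. Let \<open>(Y, d)\<close> be a coalgebra
  over the conjugate comonad. The functor \<open>H\<close> carries the two arrows whose equalizer defines the
  right adjoint at \<open>(Y, d)\<close> to \<open>\<delta>\<^sup>v\<close> and \<open>H C K d\<close>, and these two arrows together with \<open>d\<close> form
  the standard split cofork of a coalgebra, with splittings \<open>\<epsilon>\<^sup>v\<close> at \<open>Y\<close> and \<open>\<epsilon>\<^sup>v\<close> at \<open>H C K Y\<close>
  (\<open>pair_split_cofork\<close>). The arrow \<open>C K \<epsilon>\<^sup>v\<close> retracts both arrows (\<open>pair_coreflexive\<close>). So the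
  hypotheses apply to this pair: it has an equalizer \<open>e\<close> in the base category, and because \<open>C\<close> and
  \<open>C\<^sup>2\<close> preserve it, \<open>e\<close> carries a coalgebra structure that makes it an equalizer of
  coalgebras (\<open>coalg_equalizer_create\<close>).

  Now \<open>H e\<close> and \<open>d\<close> are equalizers of the same pair, so \<open>\<epsilon>\<^sup>v \<circ> H e\<close>, being the comparison between
  them, is invertible. But this composite is exactly the counit of the lifted adjunction
  (\<open>counit_arr_iso\<close>). By the first triangle identity \<open>H\<close> sends the lifted unit to the inverse of a
  counit component, and since \<open>H\<close> is conservative the unit is invertible as well (\<open>unit_iso\<close>).

  The remaining axioms of an adjunction follow formally. The lifted left adjoint is faithful, because
  the arrow \<open>C \<eta> \<circ> c\<close> attached to a coalgebra \<open>(X, c)\<close> factors as the invertible unit followed by an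
  equalizer and is therefore monic (\<open>H_gam_faithful\<close>). For a faithful functor with a natural
  invertible counit, the functoriality of the right adjoint, the naturality of the unit and the second
  triangle identity can all be checked after applying the functor and cancelling the counit
  (\<open>adjoint_equivalenceI\<close>).
\<close>

section \<open>Arrows, isomorphisms and equalizers\<close>

lemma mem_hom [simp]: "f \<in> hom A X Y \<longleftrightarrow> f \<in> Arr A \<and> Dom A f = X \<and> Cod A f = Y"
  by (auto simp: hom_def)

lemma und_simps [simp]: "und (S, f, S') = f"
  by (simp add: und_def)

context category
begin

lemma obj_arr [simp]:
  assumes "f \<in> Arr A"
  shows "Dom A f \<in> Obj A" "Cod A f \<in> Obj A"
  using assms Dom_Obj Cod_Obj by auto

lemma ident_arr [simp]:
  assumes "X \<in> Obj A"
  shows "Ident A X \<in> Arr A" "Dom A (Ident A X) = X" "Cod A (Ident A X) = X"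
  using Ident_hom[OF assms] by auto

lemma comp_arr [simp]:
  assumes "f \<in> Arr A" "g \<in> Arr A" "Cod A f = Dom A g"
  shows "g \<cdot> f \<in> Arr A" "Dom A (g \<cdot> f) = Dom A f" "Cod A (g \<cdot> f) = Cod A g"
  using Comp_hom[of f "Dom A f" "Cod A f" g "Cod A g"] assms by auto

lemma comp_ident [simp]:
  assumes "f \<in> Arr A"
  shows "Cod A f = Y \<Longrightarrow> Ident A Y \<cdot> f = f" "Dom A f = X \<Longrightarrow> f \<cdot> Ident A X = f"
  using Ident_left[of f "Dom A f" "Cod A f"] Ident_right[of f "Dom A f" "Cod A f"] assms by auto

lemma comp_assoc [simp]:
  assumes "f \<in> Arr A" "g \<in> Arr A" "h \<in> Arr A" "Cod A f = Dom A g" "Cod A g = Dom A h"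
  shows "(h \<cdot> g) \<cdot> f = h \<cdot> g \<cdot> f"
  using Comp_assoc[of f "Dom A f" "Cod A f" g "Cod A g" h "Cod A h"] assms by auto

text \<open>Composites are kept bracketed to the right, so an equation between two-fold composites rewrites
  only the end of a chain. This form lets it act in the middle of one.\<close>

lemma comp_square:
  assumes "a \<cdot> b = c \<cdot> d" "a \<in> Arr A" "b \<in> Arr A" "c \<in> Arr A" "d \<in> Arr A"
    "Cod A b = Dom A a" "Cod A d = Dom A c" "x \<in> Arr A" "Cod A x = Dom A b" "Cod A x = Dom A d"
  shows "a \<cdot> b \<cdot> x = c \<cdot> d \<cdot> x"
  using assms comp_assoc[of x b a] comp_assoc[of x d c] by metis

lemma comp_cancel:
  assumes "a \<cdot> b = Ident A (Dom A b)" "a \<in> Arr A" "b \<in> Arr A" "Cod A b = Dom A a"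
    "x \<in> Arr A" "Cod A x = Dom A b"
  shows "a \<cdot> b \<cdot> x = x"
  using assms comp_assoc[of x b a] by simp

lemma isoI:
  assumes "f \<in> Arr A" "g \<in> Arr A" "Dom A g = Cod A f" "Cod A g = Dom A f"
    "g \<cdot> f = Ident A (Dom A f)" "f \<cdot> g = Ident A (Cod A f)"
  shows "iso A f"
  using assms by (auto simp: iso_def intro!: bexI[of _ g])

lemma isoE:
  assumes "iso A f"
  obtains g where "f \<in> Arr A" "g \<in> Arr A" "Dom A g = Cod A f" "Cod A g = Dom A f"
    "g \<cdot> f = Ident A (Dom A f)" "f \<cdot> g = Ident A (Cod A f)"
  using assms by (auto simp: iso_def)

lemma iso_cancel_left:
  assumes "iso A f" "u \<in> Arr A" "v \<in> Arr A" "Cod A u = Dom A f" "Cod A v = Dom A f"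
    "f \<cdot> u = f \<cdot> v"
  shows "u = v"
proof -
  obtain g where g: "f \<in> Arr A" "g \<in> Arr A" "Dom A g = Cod A f" "g \<cdot> f = Ident A (Dom A f)"
    using assms(1) by (rule isoE)
  have "(g \<cdot> f) \<cdot> u = (g \<cdot> f) \<cdot> v"
    using assms g(1-3) by simp
  then show ?thesis
    using assms g by simp
qed

lemma iso_section:
  assumes "iso A f" "s \<in> Arr A" "Dom A s = Cod A f" "Cod A s = Dom A f"
    "f \<cdot> s = Ident A (Cod A f)"
  shows "iso A s"
proof -
  have f: "f \<in> Arr A"
    using assms(1) by (simp add: iso_def)
  have "f \<cdot> s \<cdot> f = (f \<cdot> s) \<cdot> f"
    using assms(2-4) f by simp
  also have "\<dots> = f \<cdot> Ident A (Dom A f)"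
    using assms(5) f by simp
  finally have "s \<cdot> f = Ident A (Dom A f)"
    using assms f by - (rule iso_cancel_left[OF assms(1)], simp_all)
  then show ?thesis
    using assms f by (intro isoI[of s f]) simp_all
qed

lemma equalizerD:
  assumes "equalizer A f g e"
  shows "f \<in> Arr A" "g \<in> Arr A" "Dom A g = Dom A f" "Cod A g = Cod A f"
    "e \<in> Arr A" "Cod A e = Dom A f" "f \<cdot> e = g \<cdot> e"
  using assms by (auto simp: equalizer_def parallel_def)

lemma equalizer_factor_ex1:
  assumes "equalizer A f g e" "h \<in> Arr A" "Cod A h = Dom A f" "f \<cdot> h = g \<cdot> h"
  shows "\<exists>!u. u \<in> hom A (Dom A h) (Dom A e) \<and> e \<cdot> u = h"
  using assms unfolding equalizer_def by blast

lemma equalizer_factor: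
  assumes "equalizer A f g e" "h \<in> Arr A" "Cod A h = Dom A f" "f \<cdot> h = g \<cdot> h"
  obtains u where "u \<in> Arr A" "Dom A u = Dom A h" "Cod A u = Dom A e" "e \<cdot> u = h"
  using equalizer_factor_ex1[OF assms] by auto

lemma equalizer_monic:
  assumes e: "equalizer A f g e" and uv: "u \<in> Arr A" "v \<in> Arr A" "Dom A u = Dom A v"
    "Cod A u = Dom A e" "Cod A v = Dom A e" "e \<cdot> u = e \<cdot> v"
  shows "u = v"
proof -
  note E = equalizerD[OF e]
  have "f \<cdot> e \<cdot> u = g \<cdot> e \<cdot> u"
    using comp_square[OF E(7)] E uv by simp
  then have "\<exists>!w. w \<in> hom A (Dom A (e \<cdot> u)) (Dom A e) \<and> e \<cdot> w = e \<cdot> u"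
    using E uv by (intro equalizer_factor_ex1[OF e]) simp_all
  then show ?thesis
    using E uv by auto
qed

lemma equalizerI:
  assumes "f \<in> Arr A" "g \<in> Arr A" "Dom A g = Dom A f" "Cod A g = Cod A f"
    "e \<in> Arr A" "Cod A e = Dom A f" "f \<cdot> e = g \<cdot> e"
    and ex: "\<And>h. h \<in> Arr A \<Longrightarrow> Cod A h = Dom A f \<Longrightarrow> f \<cdot> h = g \<cdot> h
      \<Longrightarrow> \<exists>u\<in>Arr A. Dom A u = Dom A h \<and> Cod A u = Dom A e \<and> e \<cdot> u = h"
    and monic: "\<And>u v. u \<in> Arr A \<Longrightarrow> v \<in> Arr A \<Longrightarrow> Dom A u = Dom A v \<Longrightarrow> Cod A u = Dom A e
      \<Longrightarrow> Cod A v = Dom A e \<Longrightarrow> e \<cdot> u = e \<cdot> v \<Longrightarrow> u = v"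
  shows "equalizer A f g e"
  unfolding equalizer_def parallel_def
proof (intro conjI ballI impI)
  fix h assume "h \<in> Arr A" "Cod A h = Dom A f \<and> f \<cdot> h = g \<cdot> h"
  then obtain u where "u \<in> Arr A \<and> Dom A u = Dom A h \<and> Cod A u = Dom A e \<and> e \<cdot> u = h"
    using ex by blast
  then show "\<exists>!u. u \<in> hom A (Dom A h) (Dom A e) \<and> e \<cdot> u = h"
    by (intro ex1I[of _ u]) (auto intro!: monic)
qed (use assms in auto)

lemma equalizer_unique:
  assumes e: "equalizer A f g e" and e': "equalizer A f g e'"
  obtains i where "iso A i" "Dom A i = Dom A e'" "Cod A i = Dom A e" "e \<cdot> i = e'"
proof -
  note E = equalizerD[OF e] and E' = equalizerD[OF e']
  obtain i where i: "i \<in> Arr A" "Dom A i = Dom A e'" "Cod A i = Dom A e" "e \<cdot> i = e'"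
    using equalizer_factor[OF e] E' by metis
  obtain j where j: "j \<in> Arr A" "Dom A j = Dom A e" "Cod A j = Dom A e'" "e' \<cdot> j = e"
    using equalizer_factor[OF e'] E by metis
  have "e' \<cdot> j \<cdot> i = e'"
    using comp_assoc[of i j e'] i j E' by simp
  then have ji: "j \<cdot> i = Ident A (Dom A i)"
    using i j E' by - (rule equalizer_monic[OF e'], simp_all)
  have "e \<cdot> i \<cdot> j = e"
    using comp_assoc[of j i e] i j E by simp
  then have "i \<cdot> j = Ident A (Cod A i)"
    using i j E by - (rule equalizer_monic[OF e], simp_all)
  then have "iso A i"
    using ji i j by (intro isoI[of i j]) simp_all
  then show ?thesis
    using i that by blast
qed

lemma equalizer_precomp_iso:
  assumes e: "equalizer A f g e" and i: "iso A i" "Cod A i = Dom A e"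
  shows "equalizer A f g (e \<cdot> i)"
proof -
  note E = equalizerD[OF e]
  obtain j where j: "i \<in> Arr A" "j \<in> Arr A" "Dom A j = Cod A i" "Cod A j = Dom A i"
    "j \<cdot> i = Ident A (Dom A i)" "i \<cdot> j = Ident A (Cod A i)"
    using i(1) by (rule isoE)
  show ?thesis
  proof (rule equalizerI)
    show "f \<cdot> e \<cdot> i = g \<cdot> e \<cdot> i"
      using comp_square[OF E(7)] E i j by simp
  next
    fix h assume h: "h \<in> Arr A" "Cod A h = Dom A f" "f \<cdot> h = g \<cdot> h"
    obtain u where u: "u \<in> Arr A" "Dom A u = Dom A h" "Cod A u = Dom A e" "e \<cdot> u = h"
      using equalizer_factor[OF e h] .
    have "i \<cdot> j \<cdot> u = u"
      using comp_assoc[of u j i] u i(2) j by simp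
    then show "\<exists>u\<in>Arr A. Dom A u = Dom A h \<and> Cod A u = Dom A (e \<cdot> i) \<and> (e \<cdot> i) \<cdot> u = h"
      using E u i(2) j by (intro bexI[of _ "j \<cdot> u"]) simp_all
  next
    fix u v assume uv: "u \<in> Arr A" "v \<in> Arr A" "Dom A u = Dom A v" "Cod A u = Dom A (e \<cdot> i)"
      "Cod A v = Dom A (e \<cdot> i)" "(e \<cdot> i) \<cdot> u = (e \<cdot> i) \<cdot> v"
    then have "i \<cdot> u = i \<cdot> v"
      using E i(2) j by - (rule equalizer_monic[OF e], simp_all)
    then show "u = v"
      using uv E i(2) j by - (rule iso_cancel_left[OF i(1)], simp_all)
  qed (use E i j in simp_all)
qed

text \<open>The splitting factors a competing arrow \<open>h\<close> as \<open>p \<circ> h\<close>, since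
  \<open>e \<circ> p \<circ> h = q \<circ> g \<circ> h = q \<circ> f \<circ> h = h\<close>.\<close>

lemma split_cofork_equalizer:
  assumes "split_cofork A e f g"
  shows "equalizer A f g e"
proof -
  have fg: "f \<in> Arr A" "g \<in> Arr A" "Dom A g = Dom A f" "Cod A g = Cod A f"
    and e: "e \<in> Arr A" "Cod A e = Dom A f" "f \<cdot> e = g \<cdot> e"
    using assms by (auto simp: split_cofork_def parallel_def)
  obtain p q where p: "p \<in> Arr A" "Dom A p = Dom A f" "Cod A p = Dom A e" "p \<cdot> e = Ident A (Dom A e)"
    and q: "q \<in> Arr A" "Dom A q = Cod A f" "Cod A q = Dom A f" "q \<cdot> f = Ident A (Dom A f)"
    and ep: "e \<cdot> p = q \<cdot> g"
    using assms by (auto simp: split_cofork_def)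
  show ?thesis
  proof (rule equalizerI[OF fg e])
    fix h assume h: "h \<in> Arr A" "Cod A h = Dom A f" "f \<cdot> h = g \<cdot> h"
    have "e \<cdot> p \<cdot> h = q \<cdot> g \<cdot> h"
      using fg e p q h by - (rule comp_square[OF ep], simp_all)
    also have "\<dots> = (q \<cdot> f) \<cdot> h"
      using fg e(1,2) p(1-3) q(1-3) h by simp
    also have "\<dots> = h"
      using q h by simp
    finally show "\<exists>u\<in>Arr A. Dom A u = Dom A h \<and> Cod A u = Dom A e \<and> e \<cdot> u = h"
      using e p h by (intro bexI[of _ "p \<cdot> h"]) simp_all
  next
    fix u v assume uv: "u \<in> Arr A" "v \<in> Arr A" "Dom A u = Dom A v" "Cod A u = Dom A e"
      "Cod A v = Dom A e" "e \<cdot> u = e \<cdot> v"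
    have "(p \<cdot> e) \<cdot> u = (p \<cdot> e) \<cdot> v"
      using uv e p(1-3) by simp
    then show "u = v"
      using uv p(4) by simp
  qed
qed

text \<open>A retraction of one equalizer, restricted to another equalizer of the same pair, is the comparison
  arrow between them.\<close>

lemma equalizer_retraction_iso:
  assumes e: "equalizer A f g e" and e': "equalizer A f g e'"
    and p: "p \<in> Arr A" "Dom A p = Dom A f" "Cod A p = Dom A e" "p \<cdot> e = Ident A (Dom A e)"
  shows "iso A (p \<cdot> e')"
proof -
  obtain i where i: "iso A i" "Dom A i = Dom A e'" "Cod A i = Dom A e" "e \<cdot> i = e'"
    using equalizer_unique[OF e e'] .
  have iA: "i \<in> Arr A"
    using i(1) by (simp add: iso_def)
  have "p \<cdot> e' = (p \<cdot> e) \<cdot> i"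
    using i iA p equalizerD[OF e] by (subst comp_assoc) simp_all
  then show ?thesis
    using i iA p by simp
qed

end

lemma is_functorD:
  assumes "is_functor A B F"
  shows "category A" "category B"
    and "X \<in> Obj A \<Longrightarrow> omap F X \<in> Obj B"
    and "f \<in> Arr A \<Longrightarrow> amap F f \<in> Arr B"
    and "f \<in> Arr A \<Longrightarrow> Dom B (amap F f) = omap F (Dom A f)"
    and "f \<in> Arr A \<Longrightarrow> Cod B (amap F f) = omap F (Cod A f)"
    and "X \<in> Obj A \<Longrightarrow> amap F (Ident A X) = Ident B (omap F X)"
    and "f \<in> Arr A \<Longrightarrow> g \<in> Arr A \<Longrightarrow> Cod A f = Dom A g
      \<Longrightarrow> amap F (g \<cdot>\<^bsub>A\<^esub> f) = amap F g \<cdot>\<^bsub>B\<^esub> amap F f"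
  using assms unfolding is_functor_def by (auto simp: hom_def)

lemma functor_square:
  assumes "is_functor A B F" "a \<cdot>\<^bsub>A\<^esub> b = c \<cdot>\<^bsub>A\<^esub> d" "a \<in> Arr A" "b \<in> Arr A" "c \<in> Arr A" "d \<in> Arr A"
    "Cod A b = Dom A a" "Cod A d = Dom A c"
  shows "amap F a \<cdot>\<^bsub>B\<^esub> amap F b = amap F c \<cdot>\<^bsub>B\<^esub> amap F d"
  using assms is_functorD(8)[OF assms(1)] by metis

lemma functor_cancel:
  assumes "is_functor A B F" "a \<cdot>\<^bsub>A\<^esub> b = Ident A X" "a \<in> Arr A" "b \<in> Arr A"
    "Cod A b = Dom A a" "X \<in> Obj A"
  shows "amap F a \<cdot>\<^bsub>B\<^esub> amap F b = Ident B (omap F X)"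
  using assms is_functorD(7,8)[OF assms(1)] by metis

section \<open>Adjoint equivalences from an invertible counit\<close>

text \<open>Under \<open>L\<close> the arrow \<open>s\<close> becomes a section of an isomorphism, hence itself an isomorphism.\<close>

lemma unit_iso_of_counit_iso:
  assumes L: "is_functor A B L" and cons: "conservative A B L"
    and X: "X \<in> Obj A" and s: "s \<in> Arr A" "Dom A s = X"
    and t: "iso B t" "Dom B t = omap L (Cod A s)" "Cod B t = omap L X"
    and ts: "t \<cdot>\<^bsub>B\<^esub> amap L s = Ident B (omap L X)"
  shows "iso A s"
proof -
  interpret B: category B using is_functorD(2)[OF L] .
  have "iso B (amap L s)"
    using s t ts is_functorD[OF L] by (intro B.iso_section[OF t(1)]) simp_all
  then show ?thesis
    using cons s by (simp add: conservative_def)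
qed

text \<open>When the counit is invertible and \<open>L\<close> is faithful, two parallel arrows into a value of \<open>R\<close> agree
  as soon as their images under \<open>L\<close> agree after composition with the counit. Functoriality of \<open>R\<close>,
  naturality of the unit and the second triangle identity are equations of this kind, and naturality
  of the counit together with the first triangle identity settles each of them.\<close>

lemma adjoint_equivalenceI:
  assumes L: "is_functor A B L" and cons: "conservative A B L"
    and faithful: "\<And>f g. parallel A f g \<Longrightarrow> amap L f = amap L g \<Longrightarrow> f = g"
    and R_obj: "\<And>Y. Y \<in> Obj B \<Longrightarrow> omap R Y \<in> Obj A"
    and R_arr: "\<And>g. g \<in> Arr B \<Longrightarrow> amap R g \<in> hom A (omap R (Dom B g)) (omap R (Cod B g))"
    and xi_hom: "\<And>Y. Y \<in> Obj B \<Longrightarrow> \<xi> Y \<in> hom B (omap L (omap R Y)) Y"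
    and xi_iso: "\<And>Y. Y \<in> Obj B \<Longrightarrow> iso B (\<xi> Y)"
    and xi_nat: "\<And>g. g \<in> Arr B \<Longrightarrow>
      \<xi> (Cod B g) \<cdot>\<^bsub>B\<^esub> amap L (amap R g) = g \<cdot>\<^bsub>B\<^esub> \<xi> (Dom B g)"
    and eta_hom: "\<And>X. X \<in> Obj A \<Longrightarrow> \<eta> X \<in> hom A X (omap R (omap L X))"
    and triangle: "\<And>X. X \<in> Obj A \<Longrightarrow> \<xi> (omap L X) \<cdot>\<^bsub>B\<^esub> amap L (\<eta> X) = Ident B (omap L X)"
  shows "adjoint_equivalence A B L R \<eta> \<xi>"
proof -
  interpret A: category A using is_functorD(1)[OF L] .
  interpret B: category B using is_functorD(2)[OF L] .
  note Ls [simp] = is_functorD(3-8)[OF L]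
  note [simp] = R_obj triangle
  have Rs [simp]: "amap R g \<in> Arr A" "Dom A (amap R g) = omap R (Dom B g)"
    "Cod A (amap R g) = omap R (Cod B g)" if "g \<in> Arr B" for g
    using R_arr[OF that] by auto
  have xis [simp]: "\<xi> Y \<in> Arr B" "Dom B (\<xi> Y) = omap L (omap R Y)" "Cod B (\<xi> Y) = Y"
    if "Y \<in> Obj B" for Y
    using xi_hom[OF that] by auto
  have etas [simp]: "\<eta> X \<in> Arr A" "Dom A (\<eta> X) = X" "Cod A (\<eta> X) = omap R (omap L X)"
    if "X \<in> Obj A" for X
    using eta_hom[OF that] by auto
  have xi_nat': "\<xi> Y \<cdot>\<^bsub>B\<^esub> amap L (amap R g) = g \<cdot>\<^bsub>B\<^esub> \<xi> (Dom B g)"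
    if "g \<in> Arr B" "Cod B g = Y" for g Y
    using xi_nat that by auto
  have xi_nat_comp: "\<xi> Y \<cdot>\<^bsub>B\<^esub> amap L (amap R g) \<cdot>\<^bsub>B\<^esub> h = g \<cdot>\<^bsub>B\<^esub> \<xi> (Dom B g) \<cdot>\<^bsub>B\<^esub> h"
    if "g \<in> Arr B" "Cod B g = Y" "h \<in> Arr B" "Cod B h = omap L (omap R (Dom B g))" for g h Y
    using that by (intro B.comp_square[OF xi_nat']) auto
  have cancel: "u = v" if "parallel A u v" "Y \<in> Obj B" "Cod A u = omap R Y"
    "\<xi> Y \<cdot>\<^bsub>B\<^esub> amap L u = \<xi> Y \<cdot>\<^bsub>B\<^esub> amap L v" for u v Y
    using that by (intro faithful, auto simp: parallel_def intro: B.iso_cancel_left[OF xi_iso[of Y]])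
  have R: "is_functor B A R"
    unfolding is_functor_def
  proof (intro conjI ballI impI)
    fix Y assume "Y \<in> Obj B"
    then show "amap R (Ident B Y) = Ident A (omap R Y)"
      by - (rule cancel[of _ _ Y], simp_all add: parallel_def xi_nat')
  next
    fix f g assume "f \<in> Arr B" "g \<in> Arr B" "Dom B g = Cod B f"
    then show "amap R (g \<cdot>\<^bsub>B\<^esub> f) = amap R g \<cdot>\<^bsub>A\<^esub> amap R f"
      by - (rule cancel[of _ _ "Cod B g"], simp_all add: parallel_def xi_nat' xi_nat_comp)
  qed (simp_all add: A.category_axioms B.category_axioms)
  have eta_iso: "iso A (\<eta> X)" if "X \<in> Obj A" for X
    using that by (intro unit_iso_of_counit_iso[OF L cons that _ _ xi_iso[of "omap L X"]]) simp_all
  have functors: "is_functor A A (R \<circ>\<^sub>F L)" "is_functor B B (L \<circ>\<^sub>F R)"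
    "is_functor A A id_ftor" "is_functor B B id_ftor"
    using A.category_axioms B.category_axioms is_functorD(3-8)[OF R]
    by (simp_all add: is_functor_def comp_ftor_def id_ftor_def)
  have "\<eta> (Cod A f) \<cdot>\<^bsub>A\<^esub> f = amap R (amap L f) \<cdot>\<^bsub>A\<^esub> \<eta> (Dom A f)" if "f \<in> Arr A" for f
  proof (rule cancel[of _ _ "omap L (Cod A f)"])
    have "\<xi> (omap L (Cod A f)) \<cdot>\<^bsub>B\<^esub> amap L (\<eta> (Cod A f)) \<cdot>\<^bsub>B\<^esub> amap L f = amap L f"
      using that B.comp_assoc[of "amap L f" "amap L (\<eta> (Cod A f))" "\<xi> (omap L (Cod A f))"] by simp
    then show "\<xi> (omap L (Cod A f)) \<cdot>\<^bsub>B\<^esub> amap L (\<eta> (Cod A f) \<cdot>\<^bsub>A\<^esub> f) =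
        \<xi> (omap L (Cod A f)) \<cdot>\<^bsub>B\<^esub> amap L (amap R (amap L f) \<cdot>\<^bsub>A\<^esub> \<eta> (Dom A f))"
      using that by (simp add: xi_nat_comp)
  qed (use that in \<open>simp_all add: parallel_def\<close>)
  then have eta: "nat_trans A A id_ftor (R \<circ>\<^sub>F L) \<eta>"
    using functors by (simp add: nat_trans_def comp_ftor_def id_ftor_def)
  have xi: "nat_trans B B (L \<circ>\<^sub>F R) id_ftor \<xi>"
    using functors by (simp add: nat_trans_def comp_ftor_def id_ftor_def xi_nat)
  have "amap R (\<xi> Y) \<cdot>\<^bsub>A\<^esub> \<eta> (omap R Y) = Ident A (omap R Y)" if "Y \<in> Obj B" for Y
    using that by - (rule cancel[of _ _ Y], simp_all add: parallel_def xi_nat_comp)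
  then show ?thesis
    unfolding adjoint_equivalence_def adjunction_def
    using L R eta xi eta_iso xi_iso by simp
qed

section \<open>Coalgebras and creation of equalizers\<close>

locale comonad_on =
  fixes A :: "('o, 'a) cat" and C :: "('o, 'a) comonad_data"
  assumes comonad: "comonad A C"
begin

abbreviation "T \<equiv> endo C"
abbreviation "\<delta> \<equiv> comult C"
abbreviation "\<epsilon> \<equiv> coun C"

lemma T_functor: "is_functor A A T"
  using comonad by (simp add: comonad_def)

sublocale category A
  using is_functorD(1)[OF T_functor] .

lemmas T_simps [simp] = is_functorD(3-8)[OF T_functor]

lemma delta_arr [simp]:
  assumes "X \<in> Obj A"
  shows "\<delta> X \<in> Arr A" "Dom A (\<delta> X) = omap T X" "Cod A (\<delta> X) = omap T (omap T X)"
  using comonad assms by (auto simp: comonad_def nat_trans_def comp_ftor_def)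

lemma eps_arr [simp]:
  assumes "X \<in> Obj A"
  shows "\<epsilon> X \<in> Arr A" "Dom A (\<epsilon> X) = omap T X" "Cod A (\<epsilon> X) = X"
  using comonad assms by (auto simp: comonad_def nat_trans_def id_ftor_def)

lemma delta_nat:
  "f \<in> Arr A \<Longrightarrow> Cod A f = Y \<Longrightarrow>
    \<delta> Y \<cdot>\<^bsub>A\<^esub> amap T f = amap T (amap T f) \<cdot>\<^bsub>A\<^esub> \<delta> (Dom A f)"
  using comonad by (auto simp: comonad_def nat_trans_def comp_ftor_def)

lemma eps_nat:
  "f \<in> Arr A \<Longrightarrow> Cod A f = Y \<Longrightarrow> \<epsilon> Y \<cdot>\<^bsub>A\<^esub> amap T f = f \<cdot>\<^bsub>A\<^esub> \<epsilon> (Dom A f)"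
  using comonad by (auto simp: comonad_def nat_trans_def id_ftor_def)

lemma coassoc: "X \<in> Obj A \<Longrightarrow> \<delta> (omap T X) \<cdot>\<^bsub>A\<^esub> \<delta> X = amap T (\<delta> X) \<cdot>\<^bsub>A\<^esub> \<delta> X"
  and eps_delta: "X \<in> Obj A \<Longrightarrow> \<epsilon> (omap T X) \<cdot>\<^bsub>A\<^esub> \<delta> X = Ident A (omap T X)"
  and T_eps_delta: "X \<in> Obj A \<Longrightarrow> amap T (\<epsilon> X) \<cdot>\<^bsub>A\<^esub> \<delta> X = Ident A (omap T X)"
  using comonad by (simp_all add: comonad_def)

lemma delta_nat_comp:
  assumes "f \<in> Arr A" "Cod A f = Y" "x \<in> Arr A" "Cod A x = omap T (Dom A f)"
  shows "\<delta> Y \<cdot>\<^bsub>A\<^esub> amap T f \<cdot>\<^bsub>A\<^esub> x = amap T (amap T f) \<cdot>\<^bsub>A\<^esub> \<delta> (Dom A f) \<cdot>\<^bsub>A\<^esub> x"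
  using assms by - (rule comp_square[OF delta_nat], auto)

lemma eps_nat_comp:
  assumes "f \<in> Arr A" "Cod A f = Y" "x \<in> Arr A" "Cod A x = omap T (Dom A f)"
  shows "\<epsilon> Y \<cdot>\<^bsub>A\<^esub> amap T f \<cdot>\<^bsub>A\<^esub> x = f \<cdot>\<^bsub>A\<^esub> \<epsilon> (Dom A f) \<cdot>\<^bsub>A\<^esub> x"
  using assms by - (rule comp_square[OF eps_nat], auto)

lemma mem_coalgebras [simp]:
  "(X, c) \<in> coalgebras A C \<longleftrightarrow> X \<in> Obj A \<and> c \<in> Arr A \<and> Dom A c = X \<and> Cod A c = omap T X \<and>
     \<delta> X \<cdot>\<^bsub>A\<^esub> c = amap T c \<cdot>\<^bsub>A\<^esub> c \<and> \<epsilon> X \<cdot>\<^bsub>A\<^esub> c = Ident A X"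
  by (auto simp: coalgebras_def)

lemma coalg_cat_simps [simp]:
  "Obj (coalg_cat A C) = coalgebras A C"
  "Dom (coalg_cat A C) (S, f, S') = S"
  "Cod (coalg_cat A C) (S, f, S') = S'"
  "Ident (coalg_cat A C) S = (S, Ident A (fst S), S)"
  "(S2, g, S3) \<cdot>\<^bsub>coalg_cat A C\<^esub> (S1, f, S4) = (S1, g \<cdot>\<^bsub>A\<^esub> f, S3)"
  by (simp_all add: coalg_cat_def)

lemma mem_coalg_arr [simp]:
  "((X, c), f, (Y, d)) \<in> Arr (coalg_cat A C) \<longleftrightarrow>
    (X, c) \<in> coalgebras A C \<and> (Y, d) \<in> coalgebras A C \<and>
    f \<in> Arr A \<and> Dom A f = X \<and> Cod A f = Y \<and> d \<cdot>\<^bsub>A\<^esub> f = amap T f \<cdot>\<^bsub>A\<^esub> c"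
  by (auto simp: coalg_cat_def)

lemma und_comp: "und (a \<cdot>\<^bsub>coalg_cat A C\<^esub> b) = und a \<cdot>\<^bsub>A\<^esub> und b"
  by (cases a; cases b) simp

lemma coalg_comp:
  assumes c: "c \<in> Arr A" "Dom A c = X" "Cod A c = omap T X"
    and d: "d \<in> Arr A" "Dom A d = Y" "Cod A d = omap T Y"
    and k: "k \<in> Arr A" "Dom A k = Z" "Cod A k = omap T Z"
    and f: "f \<in> Arr A" "Dom A f = X" "Cod A f = Y" "d \<cdot>\<^bsub>A\<^esub> f = amap T f \<cdot>\<^bsub>A\<^esub> c"
    and g: "g \<in> Arr A" "Dom A g = Y" "Cod A g = Z" "k \<cdot>\<^bsub>A\<^esub> g = amap T g \<cdot>\<^bsub>A\<^esub> d"
  shows "k \<cdot>\<^bsub>A\<^esub> g \<cdot>\<^bsub>A\<^esub> f = amap T g \<cdot>\<^bsub>A\<^esub> amap T f \<cdot>\<^bsub>A\<^esub> c"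
proof -
  have "k \<cdot>\<^bsub>A\<^esub> g \<cdot>\<^bsub>A\<^esub> f = amap T g \<cdot>\<^bsub>A\<^esub> d \<cdot>\<^bsub>A\<^esub> f"
    using assms(1-13) g by - (rule comp_square[OF g(4)], simp_all)
  also have "\<dots> = amap T g \<cdot>\<^bsub>A\<^esub> amap T f \<cdot>\<^bsub>A\<^esub> c"
    by (simp add: f(4))
  finally show ?thesis .
qed

lemma coalg_homE:
  assumes "f \<in> hom (coalg_cat A C) S S'"
  obtains X c h Y d where "S = (X, c)" "S' = (Y, d)" "f = ((X, c), h, (Y, d))"
    "(X, c) \<in> coalgebras A C" "(Y, d) \<in> coalgebras A C"
    "h \<in> Arr A" "Dom A h = X" "Cod A h = Y" "d \<cdot>\<^bsub>A\<^esub> h = amap T h \<cdot>\<^bsub>A\<^esub> c"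
  using assms by (auto simp: coalg_cat_def)

lemma category_coalg_cat: "category (coalg_cat A C)"
proof
  fix S S' S'' f g
  assume f: "f \<in> hom (coalg_cat A C) S S'" and g: "g \<in> hom (coalg_cat A C) S' S''"
  obtain X c h Y d where f': "S = (X, c)" "S' = (Y, d)" "f = ((X, c), h, (Y, d))"
    "(X, c) \<in> coalgebras A C" "(Y, d) \<in> coalgebras A C"
    "h \<in> Arr A" "Dom A h = X" "Cod A h = Y" "d \<cdot>\<^bsub>A\<^esub> h = amap T h \<cdot>\<^bsub>A\<^esub> c"
    using f by (rule coalg_homE)
  obtain Z k i where g': "S'' = (Z, k)" "g = ((Y, d), i, (Z, k))" "(Z, k) \<in> coalgebras A C"
    "i \<in> Arr A" "Dom A i = Y" "Cod A i = Z" "k \<cdot>\<^bsub>A\<^esub> i = amap T i \<cdot>\<^bsub>A\<^esub> d"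
    by (rule coalg_homE[OF g]) (auto simp: f'(2))
  have "k \<cdot>\<^bsub>A\<^esub> i \<cdot>\<^bsub>A\<^esub> h = amap T i \<cdot>\<^bsub>A\<^esub> amap T h \<cdot>\<^bsub>A\<^esub> c"
    using f' g' by (intro coalg_comp[of c X d Y k Z h i]) simp_all
  then show "g \<cdot>\<^bsub>coalg_cat A C\<^esub> f \<in> hom (coalg_cat A C) S S''"
    using f' g' by simp
next
  fix S1 S2 S3 S4 f g h
  assume "f \<in> hom (coalg_cat A C) S1 S2" "g \<in> hom (coalg_cat A C) S2 S3"
    "h \<in> hom (coalg_cat A C) S3 S4"
  then show "(h \<cdot>\<^bsub>coalg_cat A C\<^esub> g) \<cdot>\<^bsub>coalg_cat A C\<^esub> f =
      h \<cdot>\<^bsub>coalg_cat A C\<^esub> (g \<cdot>\<^bsub>coalg_cat A C\<^esub> f)"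
    by (elim coalg_homE) (simp only: coalg_cat_simps prod.inject comp_assoc simp_thms)
next
  fix S S' f assume "f \<in> hom (coalg_cat A C) S S'"
  then show "Ident (coalg_cat A C) S' \<cdot>\<^bsub>coalg_cat A C\<^esub> f = f"
    "f \<cdot>\<^bsub>coalg_cat A C\<^esub> Ident (coalg_cat A C) S = f"
    by (elim coalg_homE; simp)+
next
  fix f assume "f \<in> Arr (coalg_cat A C)"
  then show "Dom (coalg_cat A C) f \<in> Obj (coalg_cat A C)"
    "Cod (coalg_cat A C) f \<in> Obj (coalg_cat A C)"
    by (auto simp: coalg_cat_def)
next
  fix S assume "S \<in> Obj (coalg_cat A C)"
  then show "Ident (coalg_cat A C) S \<in> hom (coalg_cat A C) S S"
    by (cases S) simp
qed

text \<open>The inverse of an invertible coalgebra morphism again commutes with the structures, so the forgetful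
  functor reflects isomorphisms.\<close>

lemma coalg_iso:
  assumes a: "((X, c), f, (Y, d)) \<in> Arr (coalg_cat A C)" and f: "iso A f"
  shows "iso (coalg_cat A C) ((X, c), f, (Y, d))"
proof -
  interpret E: category "coalg_cat A C" by (rule category_coalg_cat)
  obtain g where g: "g \<in> Arr A" "Dom A g = Cod A f" "Cod A g = Dom A f"
    "g \<cdot>\<^bsub>A\<^esub> f = Ident A (Dom A f)" "f \<cdot>\<^bsub>A\<^esub> g = Ident A (Cod A f)"
    using isoE[OF f] by blast
  have "c \<cdot>\<^bsub>A\<^esub> g = amap T (g \<cdot>\<^bsub>A\<^esub> f) \<cdot>\<^bsub>A\<^esub> c \<cdot>\<^bsub>A\<^esub> g"
    using a g by simp
  also have "\<dots> = amap T g \<cdot>\<^bsub>A\<^esub> amap T f \<cdot>\<^bsub>A\<^esub> c \<cdot>\<^bsub>A\<^esub> g"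
    using a g(1-3) by simp
  also have "\<dots> = amap T g \<cdot>\<^bsub>A\<^esub> d \<cdot>\<^bsub>A\<^esub> f \<cdot>\<^bsub>A\<^esub> g"
    using a g(1-3) by (subst comp_square[of "amap T f" c d f]) simp_all
  also have "\<dots> = amap T g \<cdot>\<^bsub>A\<^esub> d"
    using a g by simp
  finally have "c \<cdot>\<^bsub>A\<^esub> g = amap T g \<cdot>\<^bsub>A\<^esub> d" .
  then show ?thesis
    using a g by (intro E.isoI[of _ "((Y, d), g, (X, c))"]) simp_all
qed

lemma iso_und:
  assumes "iso (coalg_cat A C) ((X, c), f, (Y, d))"
  shows "iso A f"
proof -
  interpret E: category "coalg_cat A C" by (rule category_coalg_cat)
  let ?f = "((X, c), f, (Y, d))"
  obtain g where f: "?f \<in> Arr (coalg_cat A C)" and g: "g \<in> hom (coalg_cat A C) (Y, d) (X, c)"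
    "g \<cdot>\<^bsub>coalg_cat A C\<^esub> ?f = Ident (coalg_cat A C) (X, c)"
    "?f \<cdot>\<^bsub>coalg_cat A C\<^esub> g = Ident (coalg_cat A C) (Y, d)"
    using assms unfolding iso_def coalg_cat_simps by blast
  show ?thesis
    using g(1)
  proof (rule coalg_homE)
    fix Y' d' h X' c' assume h: "(Y, d) = (Y', d')" "(X, c) = (X', c')" "g = ((Y', d'), h, (X', c'))"
      "h \<in> Arr A" "Dom A h = Y'" "Cod A h = X'"
    then show "iso A f"
      using f g(2,3) by (intro isoI[of f h]) simp_all
  qed
qed

text \<open>The forgetful functor creates equalizers that are preserved by the comonad and its square. The
  structure on the equalizer object is the factorization of \<open>s \<circ> e\<close> through \<open>T e\<close>. Its counit law
  holds because \<open>e\<close> is monic, its coassociativity law because \<open>T (T e)\<close> is monic, and induced arrows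
  are coalgebra morphisms because \<open>T e\<close> is monic.\<close>

lemma coalg_equalizer_create:
  assumes f: "((X, s), f, (Y, t)) \<in> Arr (coalg_cat A C)"
    and g: "((X, s), g, (Y, t)) \<in> Arr (coalg_cat A C)"
    and e: "equalizer A f g e"
    and Te: "equalizer A (amap T f) (amap T g) (amap T e)"
    and TTe: "equalizer A (amap T (amap T f)) (amap T (amap T g)) (amap T (amap T e))"
  shows "\<exists>c. equalizer (coalg_cat A C) ((X, s), f, (Y, t)) ((X, s), g, (Y, t))
    ((Dom A e, c), e, (X, s))"
proof -
  interpret E: category "coalg_cat A C" by (rule category_coalg_cat)
  note E [simp] = equalizerD(5,6)[OF e]
  note fe = equalizerD(7)[OF e]
  have X [simp]: "X \<in> Obj A" "s \<in> Arr A" "Dom A s = X" "Cod A s = omap T X"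
    "\<epsilon> X \<cdot>\<^bsub>A\<^esub> s = Ident A X" "\<delta> X \<cdot>\<^bsub>A\<^esub> s = amap T s \<cdot>\<^bsub>A\<^esub> s"
    and Y [simp]: "Y \<in> Obj A" "t \<in> Arr A" "Dom A t = Y" "Cod A t = omap T Y"
    and F [simp]: "f \<in> Arr A" "Dom A f = X" "Cod A f = Y" "g \<in> Arr A" "Dom A g = X" "Cod A g = Y"
    and tf: "t \<cdot>\<^bsub>A\<^esub> f = amap T f \<cdot>\<^bsub>A\<^esub> s" and tg: "t \<cdot>\<^bsub>A\<^esub> g = amap T g \<cdot>\<^bsub>A\<^esub> s"
    using f g by auto
  have "amap T f \<cdot>\<^bsub>A\<^esub> s \<cdot>\<^bsub>A\<^esub> e = t \<cdot>\<^bsub>A\<^esub> f \<cdot>\<^bsub>A\<^esub> e"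
    by - (rule comp_square[OF tf[symmetric]], simp_all)
  also have "\<dots> = amap T g \<cdot>\<^bsub>A\<^esub> s \<cdot>\<^bsub>A\<^esub> e"
    unfolding fe by - (rule comp_square[OF tg], simp_all)
  finally obtain c where c [simp]: "c \<in> Arr A" "Dom A c = Dom A e" "Cod A c = omap T (Dom A e)"
    and ec: "amap T e \<cdot>\<^bsub>A\<^esub> c = s \<cdot>\<^bsub>A\<^esub> e"
    by - (rule equalizer_factor[OF Te, rotated -1], simp_all)
  have "amap T (amap T e) \<cdot>\<^bsub>A\<^esub> \<delta> (Dom A e) \<cdot>\<^bsub>A\<^esub> c = \<delta> X \<cdot>\<^bsub>A\<^esub> amap T e \<cdot>\<^bsub>A\<^esub> c"
    by (simp add: delta_nat_comp)
  also have "\<dots> = (\<delta> X \<cdot>\<^bsub>A\<^esub> s) \<cdot>\<^bsub>A\<^esub> e"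
    by (simp add: ec del: X(6))
  also have "\<dots> = amap T s \<cdot>\<^bsub>A\<^esub> amap T e \<cdot>\<^bsub>A\<^esub> c"
    by (simp add: ec)
  also have "\<dots> = amap T (s \<cdot>\<^bsub>A\<^esub> e) \<cdot>\<^bsub>A\<^esub> c"
    by simp
  also have "\<dots> = amap T (amap T e) \<cdot>\<^bsub>A\<^esub> amap T c \<cdot>\<^bsub>A\<^esub> c"
    by (simp flip: ec)
  finally have coassoc_c: "\<delta> (Dom A e) \<cdot>\<^bsub>A\<^esub> c = amap T c \<cdot>\<^bsub>A\<^esub> c"
    by - (rule equalizer_monic[OF TTe], simp_all)
  have "e \<cdot>\<^bsub>A\<^esub> \<epsilon> (Dom A e) \<cdot>\<^bsub>A\<^esub> c = \<epsilon> X \<cdot>\<^bsub>A\<^esub> amap T e \<cdot>\<^bsub>A\<^esub> c"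
    by (simp add: eps_nat_comp)
  also have "\<dots> = (\<epsilon> X \<cdot>\<^bsub>A\<^esub> s) \<cdot>\<^bsub>A\<^esub> e"
    by (simp add: ec del: X(5))
  finally have counit_c: "\<epsilon> (Dom A e) \<cdot>\<^bsub>A\<^esub> c = Ident A (Dom A e)"
    by - (rule equalizer_monic[OF e], simp_all)
  have e_arr: "((Dom A e, c), e, (X, s)) \<in> Arr (coalg_cat A C)"
    using coassoc_c counit_c f by (simp add: ec)
  have "equalizer (coalg_cat A C) ((X, s), f, (Y, t)) ((X, s), g, (Y, t)) ((Dom A e, c), e, (X, s))"
  proof (rule E.equalizerI[OF f g _ _ e_arr])
    fix h assume h: "h \<in> Arr (coalg_cat A C)" "Cod (coalg_cat A C) h =
      Dom (coalg_cat A C) ((X, s), f, (Y, t))"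
      and eq: "((X, s), f, (Y, t)) \<cdot>\<^bsub>coalg_cat A C\<^esub> h = ((X, s), g, (Y, t)) \<cdot>\<^bsub>coalg_cat A C\<^esub> h"
    obtain W w k where hk: "h = ((W, w), k, (X, s))"
      using h by (cases h) auto
    have k [simp]: "k \<in> Arr A" "Dom A k = W" "Cod A k = X" "w \<in> Arr A" "Dom A w = W"
      "Cod A w = omap T W" and sk: "s \<cdot>\<^bsub>A\<^esub> k = amap T k \<cdot>\<^bsub>A\<^esub> w"
      using h by (auto simp: hk)
    have "f \<cdot>\<^bsub>A\<^esub> k = g \<cdot>\<^bsub>A\<^esub> k"
      using eq by (simp add: hk)
    then obtain u where u [simp]: "u \<in> Arr A" "Dom A u = W" "Cod A u = Dom A e"
      and eu: "e \<cdot>\<^bsub>A\<^esub> u = k"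
      by - (rule equalizer_factor[OF e, rotated -1], simp_all)
    have "amap T e \<cdot>\<^bsub>A\<^esub> amap T u \<cdot>\<^bsub>A\<^esub> w = amap T (e \<cdot>\<^bsub>A\<^esub> u) \<cdot>\<^bsub>A\<^esub> w"
      by simp
    also have "\<dots> = s \<cdot>\<^bsub>A\<^esub> e \<cdot>\<^bsub>A\<^esub> u"
      by (simp only: eu sk)
    also have "\<dots> = amap T e \<cdot>\<^bsub>A\<^esub> c \<cdot>\<^bsub>A\<^esub> u"
      by - (rule comp_square[OF ec[symmetric]], simp_all)
    finally have "c \<cdot>\<^bsub>A\<^esub> u = amap T u \<cdot>\<^bsub>A\<^esub> w"
      by - (rule equalizer_monic[OF Te], simp_all)
    then show "\<exists>u\<in>Arr (coalg_cat A C). Dom (coalg_cat A C) u = Dom (coalg_cat A C) h \<and>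
        Cod (coalg_cat A C) u = Dom (coalg_cat A C) ((Dom A e, c), e, (X, s)) \<and>
        ((Dom A e, c), e, (X, s)) \<cdot>\<^bsub>coalg_cat A C\<^esub> u = h"
      using h e_arr eu by (intro bexI[of _ "((W, w), u, (Dom A e, c))"]) (simp_all add: hk)
  next
    fix u v
    assume "u \<in> Arr (coalg_cat A C)" "v \<in> Arr (coalg_cat A C)"
      "Dom (coalg_cat A C) u = Dom (coalg_cat A C) v"
      "Cod (coalg_cat A C) u = Dom (coalg_cat A C) ((Dom A e, c), e, (X, s))"
      "Cod (coalg_cat A C) v = Dom (coalg_cat A C) ((Dom A e, c), e, (X, s))"
      "((Dom A e, c), e, (X, s)) \<cdot>\<^bsub>coalg_cat A C\<^esub> u =
        ((Dom A e, c), e, (X, s)) \<cdot>\<^bsub>coalg_cat A C\<^esub> v"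
    then show "u = v"
      by (cases u; cases v) (auto intro: equalizer_monic[OF e])
  qed (simp_all add: fe)
  then show ?thesis ..
qed

text \<open>Every equalizer of coalgebras differs from the created one by an isomorphism, so a chosen equalizer
  may be treated like the created one.\<close>

lemma coalg_equalizer_und:
  assumes f: "((X, s), f, (Y, t)) \<in> Arr (coalg_cat A C)"
    and g: "((X, s), g, (Y, t)) \<in> Arr (coalg_cat A C)"
    and e: "equalizer A f g e"
    and Te: "equalizer A (amap T f) (amap T g) (amap T e)"
    and TTe: "equalizer A (amap T (amap T f)) (amap T (amap T g)) (amap T (amap T e))"
    and k: "equalizer (coalg_cat A C) ((X, s), f, (Y, t)) ((X, s), g, (Y, t)) k"
  shows "equalizer A f g (und k)"
proof -
  interpret E: category "coalg_cat A C" by (rule category_coalg_cat)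
  obtain c where c: "equalizer (coalg_cat A C) ((X, s), f, (Y, t)) ((X, s), g, (Y, t))
      ((Dom A e, c), e, (X, s))"
    using coalg_equalizer_create[OF f g e Te TTe] ..
  obtain i where i: "iso (coalg_cat A C) i" "Cod (coalg_cat A C) i = (Dom A e, c)"
    "((Dom A e, c), e, (X, s)) \<cdot>\<^bsub>coalg_cat A C\<^esub> i = k"
    using E.equalizer_unique[OF c k] by (metis coalg_cat_simps(2))
  obtain W w j where j: "i = ((W, w), j, (Dom A e, c))"
    using i(2) by (cases i) auto
  have "iso A j"
    using i(1) iso_und unfolding j by blast
  moreover have "Cod A j = Dom A e"
    using i(1) by (simp add: j iso_def)
  moreover have "und k = e \<cdot>\<^bsub>A\<^esub> j"
    unfolding i(3)[symmetric] by (simp add: j)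
  ultimately show ?thesis
    using equalizer_precomp_iso[OF e] by simp
qed

end

section \<open>The conjugate comonad\<close>

locale adjunction_comonad = comonad_on M C
  for M :: "('m, 'f) cat" and C :: "('m, 'f) comonad_data" +
  fixes N :: "('n, 'g) cat"
    and H :: "('m, 'f, 'n, 'g) ftor" and K :: "('n, 'g, 'm, 'f) ftor"
    and \<eta> :: "'m \<Rightarrow> 'f" and \<xi> :: "'n \<Rightarrow> 'g"
  assumes adj: "adjunction M N H K \<eta> \<xi>"
begin

lemma H_functor: "is_functor M N H" and K_functor: "is_functor N M K"
  using adj by (simp_all add: adjunction_def)

sublocale N: category N
  using is_functorD(2)[OF H_functor] .

lemmas H_simps [simp] = is_functorD(3-8)[OF H_functor]
lemmas K_simps [simp] = is_functorD(3-8)[OF K_functor]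

lemma eta_arr [simp]:
  assumes "X \<in> Obj M"
  shows "\<eta> X \<in> Arr M" "Dom M (\<eta> X) = X" "Cod M (\<eta> X) = omap K (omap H X)"
  using adj assms by (auto simp: adjunction_def nat_trans_def comp_ftor_def id_ftor_def)

lemma xi_arr [simp]:
  assumes "Y \<in> Obj N"
  shows "\<xi> Y \<in> Arr N" "Dom N (\<xi> Y) = omap H (omap K Y)" "Cod N (\<xi> Y) = Y"
  using adj assms by (auto simp: adjunction_def nat_trans_def comp_ftor_def id_ftor_def)

lemma eta_nat: "f \<in> Arr M \<Longrightarrow> Dom M f = X \<Longrightarrow>
    amap K (amap H f) \<cdot>\<^bsub>M\<^esub> \<eta> X = \<eta> (Cod M f) \<cdot>\<^bsub>M\<^esub> f"
  using adj by (auto simp: adjunction_def nat_trans_def comp_ftor_def id_ftor_def)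

lemma xi_nat: "f \<in> Arr N \<Longrightarrow> Cod N f = Y \<Longrightarrow>
    \<xi> Y \<cdot>\<^bsub>N\<^esub> amap H (amap K f) = f \<cdot>\<^bsub>N\<^esub> \<xi> (Dom N f)"
  using adj by (auto simp: adjunction_def nat_trans_def comp_ftor_def id_ftor_def)

lemma xi_H_eta: "X \<in> Obj M \<Longrightarrow> \<xi> (omap H X) \<cdot>\<^bsub>N\<^esub> amap H (\<eta> X) = Ident N (omap H X)"
  and K_xi_eta: "Y \<in> Obj N \<Longrightarrow> amap K (\<xi> Y) \<cdot>\<^bsub>M\<^esub> \<eta> (omap K Y) = Ident M (omap K Y)"
  using adj by (simp_all add: adjunction_def)

lemma xi_H_eta_comp: "X \<in> Obj M \<Longrightarrow> x \<in> Arr N \<Longrightarrow> Cod N x = omap H X \<Longrightarrow>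
    \<xi> (omap H X) \<cdot>\<^bsub>N\<^esub> amap H (\<eta> X) \<cdot>\<^bsub>N\<^esub> x = x"
  by (rule N.comp_cancel) (simp_all add: xi_H_eta)

lemma T_K_xi_eta: "Y \<in> Obj N \<Longrightarrow>
    amap T (amap K (\<xi> Y)) \<cdot>\<^bsub>M\<^esub> amap T (\<eta> (omap K Y)) = Ident M (omap T (omap K Y))"
  by (rule functor_cancel[OF T_functor K_xi_eta]) simp_all

lemma T_K_xi_eta_comp: "Y \<in> Obj N \<Longrightarrow> x \<in> Arr M \<Longrightarrow> Cod M x = omap T (omap K Y) \<Longrightarrow>
    amap T (amap K (\<xi> Y)) \<cdot>\<^bsub>M\<^esub> amap T (\<eta> (omap K Y)) \<cdot>\<^bsub>M\<^esub> x = x"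
  by (rule comp_cancel) (simp_all add: T_K_xi_eta)

lemma H_T_K_xi_eta_comp: "Y \<in> Obj N \<Longrightarrow> x \<in> Arr N \<Longrightarrow> Cod N x = omap H (omap T (omap K Y)) \<Longrightarrow>
    amap H (amap T (amap K (\<xi> Y))) \<cdot>\<^bsub>N\<^esub> amap H (amap T (\<eta> (omap K Y))) \<cdot>\<^bsub>N\<^esub> x = x"
  using functor_cancel[OF H_functor T_K_xi_eta[of Y]] by - (rule N.comp_cancel, simp_all)

lemma H_T_K_xi_eta: "Y \<in> Obj N \<Longrightarrow>
    amap H (amap T (amap K (\<xi> Y))) \<cdot>\<^bsub>N\<^esub> amap H (amap T (\<eta> (omap K Y))) =
    Ident N (omap H (omap T (omap K Y)))"
  by (rule functor_cancel[OF H_functor T_K_xi_eta]) simp_all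

lemma H_eps_delta_comp: "X \<in> Obj M \<Longrightarrow> x \<in> Arr N \<Longrightarrow> Cod N x = omap H (omap T X) \<Longrightarrow>
    amap H (\<epsilon> (omap T X)) \<cdot>\<^bsub>N\<^esub> amap H (\<delta> X) \<cdot>\<^bsub>N\<^esub> x = x"
  using functor_cancel[OF H_functor eps_delta[of X]] by - (rule N.comp_cancel, simp_all)

lemma H_T_eps_delta_comp: "X \<in> Obj M \<Longrightarrow> x \<in> Arr N \<Longrightarrow> Cod N x = omap H (omap T X) \<Longrightarrow>
    amap H (amap T (\<epsilon> X)) \<cdot>\<^bsub>N\<^esub> amap H (\<delta> X) \<cdot>\<^bsub>N\<^esub> x = x"
  using functor_cancel[OF H_functor T_eps_delta[of X]] by - (rule N.comp_cancel, simp_all)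

lemma H_eps_delta: "X \<in> Obj M \<Longrightarrow>
    amap H (\<epsilon> (omap T X)) \<cdot>\<^bsub>N\<^esub> amap H (\<delta> X) = Ident N (omap H (omap T X))"
  by (rule functor_cancel[OF H_functor eps_delta]) simp_all

lemma H_T_eps_delta: "X \<in> Obj M \<Longrightarrow>
    amap H (amap T (\<epsilon> X)) \<cdot>\<^bsub>N\<^esub> amap H (\<delta> X) = Ident N (omap H (omap T X))"
  by (rule functor_cancel[OF H_functor T_eps_delta]) simp_all

lemma T_eta_nat: "f \<in> Arr M \<Longrightarrow> Dom M f = X \<Longrightarrow>
    amap T (amap K (amap H f)) \<cdot>\<^bsub>M\<^esub> amap T (\<eta> X) = amap T (\<eta> (Cod M f)) \<cdot>\<^bsub>M\<^esub> amap T f"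
  by (rule functor_square[OF T_functor eta_nat]) auto

lemma H_T_eta_nat: "f \<in> Arr M \<Longrightarrow> Dom M f = X \<Longrightarrow>
    amap H (amap T (amap K (amap H f))) \<cdot>\<^bsub>N\<^esub> amap H (amap T (\<eta> X)) =
    amap H (amap T (\<eta> (Cod M f))) \<cdot>\<^bsub>N\<^esub> amap H (amap T f)"
  by (rule functor_square[OF H_functor T_eta_nat]) auto

lemma H_delta_nat: "f \<in> Arr M \<Longrightarrow> Cod M f = Y \<Longrightarrow>
    amap H (\<delta> Y) \<cdot>\<^bsub>N\<^esub> amap H (amap T f) =
    amap H (amap T (amap T f)) \<cdot>\<^bsub>N\<^esub> amap H (\<delta> (Dom M f))"
  by (rule functor_square[OF H_functor delta_nat]) auto

lemma H_eps_nat: "f \<in> Arr M \<Longrightarrow> Cod M f = Y \<Longrightarrow>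
    amap H (\<epsilon> Y) \<cdot>\<^bsub>N\<^esub> amap H (amap T f) = amap H f \<cdot>\<^bsub>N\<^esub> amap H (\<epsilon> (Dom M f))"
  by (rule functor_square[OF H_functor eps_nat]) auto

lemma H_coassoc: "X \<in> Obj M \<Longrightarrow>
    amap H (\<delta> (omap T X)) \<cdot>\<^bsub>N\<^esub> amap H (\<delta> X) = amap H (amap T (\<delta> X)) \<cdot>\<^bsub>N\<^esub> amap H (\<delta> X)"
  by (rule functor_square[OF H_functor coassoc]) auto

text \<open>The naturality squares are oriented so that the unit of the adjunction moves to the left in a
  composite, and both counits and the comultiplication move to the right. Functors are distributed
  over composites by simplification, so the image of a square under \<open>T\<close>, \<open>H\<close> or \<open>H \<circ> T\<close> is a
  rewrite rule of its own, as is the form that acts inside a longer composite.\<close>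

lemmas nat_rules =
  delta_nat eps_nat eta_nat xi_nat T_eta_nat H_T_eta_nat H_delta_nat H_eps_nat
  delta_nat_comp eps_nat_comp comp_square[OF eta_nat] N.comp_square[OF xi_nat]
  comp_square[OF T_eta_nat] N.comp_square[OF H_T_eta_nat] N.comp_square[OF H_delta_nat]
  N.comp_square[OF H_eps_nat]

lemmas cancel_rules =
  eps_delta T_eps_delta H_eps_delta H_T_eps_delta H_eps_delta_comp H_T_eps_delta_comp
  xi_H_eta K_xi_eta T_K_xi_eta H_T_K_xi_eta xi_H_eta_comp T_K_xi_eta_comp H_T_K_xi_eta_comp

abbreviation "Cv \<equiv> conj_comonad N H K \<eta> \<xi> C"

lemma conj_simps [simp]:
  "omap (endo Cv) Y = omap H (omap T (omap K Y))"
  "amap (endo Cv) f = amap H (amap T (amap K f))"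
  "comult Cv Y = amap H (amap T (\<eta> (omap T (omap K Y)))) \<cdot>\<^bsub>N\<^esub> amap H (\<delta> (omap K Y))"
  "coun Cv Y = \<xi> Y \<cdot>\<^bsub>N\<^esub> amap H (\<epsilon> (omap K Y))"
  by (simp_all add: conj_comonad_def comp_ftor_def)

lemma conj_comonad: "comonad N Cv"
proof -
  have F: "is_functor N N (endo Cv)" "is_functor N N (endo Cv \<circ>\<^sub>F endo Cv)" "is_functor N N id_ftor"
    by (simp_all add: is_functor_def N.category_axioms comp_ftor_def id_ftor_def)
  show ?thesis
    unfolding comonad_def nat_trans_def
    using F by (simp add: comp_ftor_def id_ftor_def nat_rules cancel_rules H_coassoc)
qed

sublocale V: comonad_on N Cv
  by (unfold_locales) (rule conj_comonad)

lemma H_gam_simps [simp]: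
  "omap (H_gam N H \<eta> C) (X, c) = (omap H X, amap H (amap T (\<eta> X)) \<cdot>\<^bsub>N\<^esub> amap H c)"
  "H_gam_obj N H \<eta> C (X, c) = (omap H X, amap H (amap T (\<eta> X)) \<cdot>\<^bsub>N\<^esub> amap H c)"
  "amap (H_gam N H \<eta> C) (S, f, S') = (H_gam_obj N H \<eta> C S, amap H f, H_gam_obj N H \<eta> C S')"
  by (simp_all add: H_gam_def H_gam_obj_def gam_def)

lemma H_gam_coalgebra:
  assumes "(X, c) \<in> coalgebras M C"
  shows "(omap H X, amap H (amap T (\<eta> X)) \<cdot>\<^bsub>N\<^esub> amap H c) \<in> coalgebras N Cv"
proof -
  have c: "X \<in> Obj M" "c \<in> Arr M" "Dom M c = X" "Cod M c = omap T X"
    and "\<delta> X \<cdot>\<^bsub>M\<^esub> c = amap T c \<cdot>\<^bsub>M\<^esub> c" "\<epsilon> X \<cdot>\<^bsub>M\<^esub> c = Ident M X"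
    using assms by simp_all
  then have "amap H (\<delta> X) \<cdot>\<^bsub>N\<^esub> amap H c = amap H (amap T c) \<cdot>\<^bsub>N\<^esub> amap H c"
    "amap H (\<epsilon> X) \<cdot>\<^bsub>N\<^esub> amap H c = Ident N (omap H X)"
    by (auto intro!: functor_square[OF H_functor] functor_cancel[OF H_functor])
  then show ?thesis
    using c by (simp add: nat_rules cancel_rules)
qed

lemma H_gam_arr:
  assumes "((X, c), f, (Y, d)) \<in> Arr (coalg_cat M C)"
  shows "(H_gam_obj N H \<eta> C (X, c), amap H f, H_gam_obj N H \<eta> C (Y, d)) \<in> Arr (coalg_cat N Cv)"
proof -
  have f: "c \<in> Arr M" "Dom M c = X" "Cod M c = omap T X" "d \<in> Arr M" "Dom M d = Y"
    "Cod M d = omap T Y" "f \<in> Arr M" "Dom M f = X" "Cod M f = Y" "X \<in> Obj M" "Y \<in> Obj M"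
    and df: "d \<cdot>\<^bsub>M\<^esub> f = amap T f \<cdot>\<^bsub>M\<^esub> c"
    and cd: "(X, c) \<in> coalgebras M C" "(Y, d) \<in> coalgebras M C"
    using assms by simp_all
  have "amap H d \<cdot>\<^bsub>N\<^esub> amap H f = amap H (amap T f) \<cdot>\<^bsub>N\<^esub> amap H c"
    using f by (intro functor_square[OF H_functor df]) simp_all
  then have "(amap H (amap T (\<eta> Y)) \<cdot>\<^bsub>N\<^esub> amap H d) \<cdot>\<^bsub>N\<^esub> amap H f =
      amap (endo Cv) (amap H f) \<cdot>\<^bsub>N\<^esub> amap H (amap T (\<eta> X)) \<cdot>\<^bsub>N\<^esub> amap H c"
    using f by (simp add: nat_rules)
  then show ?thesis
    unfolding H_gam_simps V.mem_coalg_arr using f H_gam_coalgebra[OF cd(1)] H_gam_coalgebra[OF cd(2)]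
    by (simp del: mem_coalgebras conj_simps)
qed

lemma H_gam_functor: "is_functor (coalg_cat M C) (coalg_cat N Cv) (H_gam N H \<eta> C)"
  unfolding is_functor_def
proof (intro conjI ballI impI)
  fix S assume "S \<in> Obj (coalg_cat M C)"
  then obtain X c where S: "S = (X, c)" "(X, c) \<in> coalgebras M C"
    by (cases S) simp
  show "omap (H_gam N H \<eta> C) S \<in> Obj (coalg_cat N Cv)"
    unfolding S H_gam_simps V.coalg_cat_simps by (rule H_gam_coalgebra[OF S(2)])
  show "amap (H_gam N H \<eta> C) (Ident (coalg_cat M C) S) =
      Ident (coalg_cat N Cv) (omap (H_gam N H \<eta> C) S)"
    using S by simp
next
  fix a assume a: "a \<in> Arr (coalg_cat M C)"
  obtain X c f Y d where a': "a = ((X, c), f, (Y, d))"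
    by (metis prod.collapse)
  show "amap (H_gam N H \<eta> C) a \<in> hom (coalg_cat N Cv)
      (omap (H_gam N H \<eta> C) (Dom (coalg_cat M C) a)) (omap (H_gam N H \<eta> C) (Cod (coalg_cat M C) a))"
    using H_gam_arr a unfolding a' by (simp del: mem_coalgebras mem_coalg_arr V.mem_coalg_arr)
next
  fix a b
  assume ab: "a \<in> Arr (coalg_cat M C)" "b \<in> Arr (coalg_cat M C)"
    "Dom (coalg_cat M C) b = Cod (coalg_cat M C) a"
  obtain X c f Y d where a': "a = ((X, c), f, (Y, d))"
    by (metis prod.collapse)
  obtain g Z k where b': "b = ((Y, d), g, (Z, k))"
    using ab(3) unfolding a' by (metis coalg_cat_simps(2,3) prod.collapse)
  have "amap H (g \<cdot>\<^bsub>M\<^esub> f) = amap H g \<cdot>\<^bsub>N\<^esub> amap H f"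
    using ab unfolding a' b' by simp
  then show "amap (H_gam N H \<eta> C) (b \<cdot>\<^bsub>coalg_cat M C\<^esub> a) =
      amap (H_gam N H \<eta> C) b \<cdot>\<^bsub>coalg_cat N Cv\<^esub> amap (H_gam N H \<eta> C) a"
    unfolding a' b' by simp
qed (simp_all add: category_coalg_cat V.category_coalg_cat)

text \<open>On underlying arrows the lifted functor is \<open>H\<close>, and isomorphisms of coalgebras are detected on
  underlying arrows.\<close>

lemma H_gam_conservative:
  assumes "conservative M N H"
  shows "conservative (coalg_cat M C) (coalg_cat N Cv) (H_gam N H \<eta> C)"
  unfolding conservative_def
proof (intro ballI impI)
  fix a assume a: "a \<in> Arr (coalg_cat M C)" and i: "iso (coalg_cat N Cv) (amap (H_gam N H \<eta> C) a)"
  obtain X c f Y d where a': "a = ((X, c), f, (Y, d))"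
    by (metis prod.collapse)
  have "iso N (amap H f)"
    using i unfolding a' H_gam_simps by (rule V.iso_und)
  moreover have "f \<in> Arr M"
    using a unfolding a' by simp
  ultimately have "iso M f"
    using assms by (simp add: conservative_def)
  then show "iso (coalg_cat M C) a"
    using a unfolding a' by (intro coalg_iso)
qed

section \<open>The defining pair of the right adjoint\<close>

text \<open>The underlying arrows of the two morphisms whose equalizer is the value of the right adjoint at
  \<open>(Y, d)\<close>.\<close>

abbreviation "pair1 Y \<equiv> amap T (\<eta> (omap T (omap K Y))) \<cdot>\<^bsub>M\<^esub> \<delta> (omap K Y)"
abbreviation "pair2 d \<equiv> amap T (amap K d)"

lemma pair_simps:
  "pair_fst M H K \<eta> C (Y, d) =
    ((omap T (omap K Y), \<delta> (omap K Y)), pair1 Y,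
     (omap T (omap K (omap H (omap T (omap K Y)))), \<delta> (omap K (omap H (omap T (omap K Y))))))"
  "pair_snd H K C (Y, d) =
    ((omap T (omap K Y), \<delta> (omap K Y)), pair2 d,
     (omap T (omap K (omap H (omap T (omap K Y)))), \<delta> (omap K (omap H (omap T (omap K Y))))))"
  by (simp_all add: pair_fst_def pair_snd_def gam_bar_def cofree_def comp_ftor_def)

text \<open>The coalgebra laws over the conjugate comonad, bracketed to the right so that they can be used for
  rewriting.\<close>

lemma conj_coalgebraD:
  assumes "(Y, d) \<in> coalgebras N Cv"
  shows "Y \<in> Obj N" "d \<in> Arr N" "Dom N d = Y" "Cod N d = omap H (omap T (omap K Y))"
    and "amap H (amap T (\<eta> (omap T (omap K Y)))) \<cdot>\<^bsub>N\<^esub> amap H (\<delta> (omap K Y)) \<cdot>\<^bsub>N\<^esub> d =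
      amap H (amap T (amap K d)) \<cdot>\<^bsub>N\<^esub> d"
    and "\<xi> Y \<cdot>\<^bsub>N\<^esub> amap H (\<epsilon> (omap K Y)) \<cdot>\<^bsub>N\<^esub> d = Ident N Y"
proof -
  show d: "Y \<in> Obj N" "d \<in> Arr N" "Dom N d = Y" "Cod N d = omap H (omap T (omap K Y))"
    using assms by simp_all
  then show "amap H (amap T (\<eta> (omap T (omap K Y)))) \<cdot>\<^bsub>N\<^esub> amap H (\<delta> (omap K Y)) \<cdot>\<^bsub>N\<^esub> d =
      amap H (amap T (amap K d)) \<cdot>\<^bsub>N\<^esub> d"
    and "\<xi> Y \<cdot>\<^bsub>N\<^esub> amap H (\<epsilon> (omap K Y)) \<cdot>\<^bsub>N\<^esub> d = Ident N Y"
    using assms by simp_all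
qed

lemma pair_coalg_arr:
  assumes "(Y, d) \<in> coalgebras N Cv"
  shows "pair_fst M H K \<eta> C (Y, d) \<in> Arr (coalg_cat M C)"
    and "pair_snd H K C (Y, d) \<in> Arr (coalg_cat M C)"
  unfolding pair_simps using conj_coalgebraD(1-4)[OF assms]
  by (simp_all add: nat_rules cancel_rules coassoc)

lemma pair_parallel:
  assumes "(Y, d) \<in> coalgebras N Cv"
  shows "parallel M (pair1 Y) (pair2 d)"
  using conj_coalgebraD(1-4)[OF assms] by (simp add: parallel_def)

text \<open>The common retraction is \<open>T K\<close> applied to the counit of the conjugate comonad at \<open>Y\<close>. It retracts
  the second arrow by the counit law of \<open>(Y, d)\<close>, and the first by the triangle identity for \<open>K\<close> and
  the counit law of the comonad.\<close>

lemma pair_coreflexive: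
  assumes "(Y, d) \<in> coalgebras N Cv"
  shows "coreflexive M (pair1 Y) (pair2 d)"
  unfolding coreflexive_def
proof (intro conjI bexI[of _ "amap T (amap K (coun Cv Y))"] pair_parallel[OF assms])
  note d = conj_coalgebraD[OF assms]
  have "amap T (amap K (coun Cv Y)) \<cdot>\<^bsub>M\<^esub> pair2 d =
      amap T (amap K (\<xi> Y \<cdot>\<^bsub>N\<^esub> amap H (\<epsilon> (omap K Y)) \<cdot>\<^bsub>N\<^esub> d))"
    using d(1-4) by simp
  also have "\<dots> = Ident M (omap T (omap K Y))"
    unfolding d(6) using d(1) by simp
  finally show "amap T (amap K (coun Cv Y)) \<cdot>\<^bsub>M\<^esub> pair2 d = Ident M (Dom M (pair1 Y))"
    using d(1) by simp
qed (use conj_coalgebraD(1-4)[OF assms] in \<open>simp_all add: nat_rules cancel_rules\<close>)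

text \<open>The functor \<open>H\<close> turns the pair into the comultiplication of the conjugate comonad at \<open>Y\<close> and the
  image of \<open>d\<close> under that comonad. Any coalgebra structure splits such a pair by counits.\<close>

lemma pair_split_cofork:
  assumes "(Y, d) \<in> coalgebras N Cv"
  shows "split_cofork N d (amap H (pair1 Y)) (amap H (pair2 d))"
proof -
  note d = conj_coalgebraD[OF assms]
  show ?thesis
    unfolding split_cofork_def
    using d by (intro conjI bexI[of _ "coun Cv Y"]
        bexI[of _ "coun Cv (omap H (omap T (omap K Y)))"])
      (simp_all add: parallel_def nat_rules cancel_rules)
qed

lemma pair_split_under:
  assumes "(Y, d) \<in> coalgebras N Cv"
  shows "split_under M N H (pair1 Y) (pair2 d)"
  using pair_split_cofork[OF assms] pair_parallel[OF assms] by (auto simp: split_under_def)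

end

section \<open>The lifted adjunction\<close>

locale beck_conditions = adjunction_comonad M C N H K \<eta> \<xi>
  for M :: "('m, 'f) cat" and C :: "('m, 'f) comonad_data" and N :: "('n, 'g) cat"
    and H :: "('m, 'f, 'n, 'g) ftor" and K :: "('n, 'g, 'm, 'f) ftor"
    and \<eta> :: "'m \<Rightarrow> 'f" and \<xi> :: "'n \<Rightarrow> 'g" +
  assumes has_equalizers: "\<And>f g. coreflexive M f g \<Longrightarrow> split_under M N H f g \<Longrightarrow>
      \<exists>e. equalizer M f g e"
    and H_preserves: "\<And>f g. coreflexive M f g \<Longrightarrow> split_under M N H f g \<Longrightarrow>
      preserves_equalizer M N H f g"
    and H_conservative: "conservative M N H"
    and T_preserves: "\<And>f g. coreflexive M f g \<Longrightarrow> split_under M N H f g \<Longrightarrow>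
      preserves_equalizer M M T f g \<and> preserves_equalizer M M (T \<circ>\<^sub>F T) f g"
begin

lemma pair_equalizer:
  assumes "(Y, d) \<in> coalgebras N Cv"
  obtains e where "equalizer M (pair1 Y) (pair2 d) e"
    and "equalizer M (amap T (pair1 Y)) (amap T (pair2 d)) (amap T e)"
    and "equalizer M (amap T (amap T (pair1 Y))) (amap T (amap T (pair2 d))) (amap T (amap T e))"
proof -
  note P = pair_coreflexive[OF assms] pair_split_under[OF assms]
  obtain e where "equalizer M (pair1 Y) (pair2 d) e"
    using has_equalizers[OF P] ..
  then show ?thesis
    using that[of e] T_preserves[OF P] unfolding preserves_equalizer_def comp_ftor_def ftor.simps
    by blast
qed

lemma equalizer_choice_exists: "\<exists>\<kappa>. equalizer_choice M N H K \<eta> \<xi> C \<kappa>"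
proof -
  have "\<exists>k. equalizer (coalg_cat M C) (pair_fst M H K \<eta> C D) (pair_snd H K C D) k"
    if D_coalg: "D \<in> coalgebras N Cv" for D
  proof -
    obtain Y d where D: "D = (Y, d)" "(Y, d) \<in> coalgebras N Cv"
      using D_coalg by (metis prod.collapse)
    obtain e where e: "equalizer M (pair1 Y) (pair2 d) e"
      "equalizer M (amap T (pair1 Y)) (amap T (pair2 d)) (amap T e)"
      "equalizer M (amap T (amap T (pair1 Y))) (amap T (amap T (pair2 d))) (amap T (amap T e))"
      using pair_equalizer[OF D(2)] .
    show ?thesis
      unfolding D(1) pair_simps
      using coalg_equalizer_create[OF pair_coalg_arr[OF D(2), unfolded pair_simps] e] by (elim exE exI)
  qed
  then show ?thesis
    unfolding equalizer_choice_def by (intro bchoice ballI)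
qed

context
  fixes \<kappa> :: "'n \<times> 'g \<Rightarrow> ('m, 'f) coalg_arr"
  assumes kappa: "equalizer_choice M N H K \<eta> \<xi> C \<kappa>"
begin

interpretation E: category "coalg_cat M C"
  by (rule category_coalg_cat)

lemma kappa_equalizer:
  assumes "(Y, d) \<in> coalgebras N Cv"
  shows "equalizer (coalg_cat M C) (pair_fst M H K \<eta> C (Y, d)) (pair_snd H K C (Y, d)) (\<kappa> (Y, d))"
  using kappa assms unfolding equalizer_choice_def by blast

text \<open>The chosen equalizers live in the category of coalgebras. The hypotheses on \<open>H\<close> concern the base
  category, so the proof needs that the underlying arrow is still an equalizer there.\<close>

lemma kappaE:
  assumes "(Y, d) \<in> coalgebras N Cv"
  obtains E c e where "\<kappa> (Y, d) = ((E, c), e, (omap T (omap K Y), \<delta> (omap K Y)))"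
    and "((E, c), e, (omap T (omap K Y), \<delta> (omap K Y))) \<in> Arr (coalg_cat M C)"
    and "equalizer M (pair1 Y) (pair2 d) e"
proof -
  obtain e' where e': "equalizer M (pair1 Y) (pair2 d) e'"
    "equalizer M (amap T (pair1 Y)) (amap T (pair2 d)) (amap T e')"
    "equalizer M (amap T (amap T (pair1 Y))) (amap T (amap T (pair2 d))) (amap T (amap T e'))"
    using pair_equalizer[OF assms] .
  obtain E c e T' where k: "\<kappa> (Y, d) = ((E, c), e, T')"
    by (metis prod.collapse)
  have "T' = (omap T (omap K Y), \<delta> (omap K Y))"
    using E.equalizerD(6)[OF kappa_equalizer[OF assms]] unfolding k pair_simps by simp
  moreover have "equalizer M (pair1 Y) (pair2 d) (und (\<kappa> (Y, d)))"
    using kappa_equalizer[OF assms] unfolding pair_simps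
    by (rule coalg_equalizer_und[OF pair_coalg_arr[OF assms, unfolded pair_simps] e'])
  ultimately show ?thesis
    using that[of E c e] E.equalizerD(5)[OF kappa_equalizer[OF assms]] unfolding k by simp
qed

text \<open>The underlying arrow of the counit is the counit of the conjugate comonad at \<open>Y\<close> composed with
  \<open>H e\<close>. The former retracts \<open>d\<close>, and both \<open>d\<close> and \<open>H e\<close> equalize the image of the pair, so the
  composite is the comparison between two equalizers.\<close>

lemma counit_arr_iso:
  assumes D: "(Y, d) \<in> coalgebras N Cv"
  shows "counit_hat M N H K \<eta> \<xi> C \<kappa> (Y, d) \<in>
      hom (coalg_cat N Cv) (H_gam_obj N H \<eta> C (K_gam_obj M C \<kappa> (Y, d))) (Y, d)"
    and "iso (coalg_cat N Cv) (counit_hat M N H K \<eta> \<xi> C \<kappa> (Y, d))"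
proof -
  note d = conj_coalgebraD[OF D]
  obtain E c e where k: "\<kappa> (Y, d) = ((E, c), e, (omap T (omap K Y), \<delta> (omap K Y)))"
    and e: "((E, c), e, (omap T (omap K Y), \<delta> (omap K Y))) \<in> Arr (coalg_cat M C)"
    and eq: "equalizer M (pair1 Y) (pair2 d) e"
    using kappaE[OF D] .
  have e' [simp]: "E \<in> Obj M" "c \<in> Arr M" "Dom M c = E" "Cod M c = omap T E"
    "e \<in> Arr M" "Dom M e = E" "Cod M e = omap T (omap K Y)"
    and ec: "\<delta> (omap K Y) \<cdot>\<^bsub>M\<^esub> e = amap T e \<cdot>\<^bsub>M\<^esub> c" and cE: "(E, c) \<in> coalgebras M C"
    using e by simp_all
  let ?u = "\<xi> Y \<cdot>\<^bsub>N\<^esub> amap H (\<epsilon> (omap K Y)) \<cdot>\<^bsub>N\<^esub> amap H e"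
  have Hec: "amap H (amap T e) \<cdot>\<^bsub>N\<^esub> amap H c = amap H (\<delta> (omap K Y)) \<cdot>\<^bsub>N\<^esub> amap H e"
    using d(1) by (intro functor_square[OF H_functor ec[symmetric]]) simp_all
  have "amap H (pair1 Y) \<cdot>\<^bsub>N\<^esub> amap H e = amap H (pair2 d) \<cdot>\<^bsub>N\<^esub> amap H e"
    using d(1-4) by (intro functor_square[OF H_functor equalizerD(7)[OF eq]]) simp_all
  then have He: "amap H (amap T (amap K d)) \<cdot>\<^bsub>N\<^esub> amap H e =
      amap H (amap T (\<eta> (omap T (omap K Y)))) \<cdot>\<^bsub>N\<^esub> amap H (\<delta> (omap K Y)) \<cdot>\<^bsub>N\<^esub> amap H e"
    using d(1-4) by simp
  \<comment> \<open>Both sides of the law for a coalgebra morphism reduce to \<open>H e\<close>: the left one because \<open>e\<close>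
    equalizes the pair, the right one because \<open>e\<close> is a morphism into a cofree coalgebra.\<close>
  have "d \<cdot>\<^bsub>N\<^esub> ?u = \<xi> (omap H (omap T (omap K Y))) \<cdot>\<^bsub>N\<^esub>
      amap H (\<epsilon> (omap K (omap H (omap T (omap K Y))))) \<cdot>\<^bsub>N\<^esub>
      amap H (amap T (amap K d)) \<cdot>\<^bsub>N\<^esub> amap H e"
    using d(1-4) by (simp add: nat_rules)
  also have "\<dots> = amap H e"
    unfolding He using d(1-4) by (simp add: nat_rules cancel_rules)
  also have "\<dots> = amap (endo Cv) ?u \<cdot>\<^bsub>N\<^esub> amap H (amap T (\<eta> E)) \<cdot>\<^bsub>N\<^esub> amap H c"
    using d(1-4) by (simp add: nat_rules cancel_rules Hec)
  finally have du: "d \<cdot>\<^bsub>N\<^esub> ?u = amap (endo Cv) ?u \<cdot>\<^bsub>N\<^esub> amap H (amap T (\<eta> E)) \<cdot>\<^bsub>N\<^esub> amap H c" .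
  have counit: "counit_hat M N H K \<eta> \<xi> C \<kappa> (Y, d) = (H_gam_obj N H \<eta> C (E, c), ?u, (Y, d))"
    by (simp add: counit_hat_def K_gam_obj_def k)
  have u_arr: "(H_gam_obj N H \<eta> C (E, c), ?u, (Y, d)) \<in> Arr (coalg_cat N Cv)"
    unfolding H_gam_simps V.mem_coalg_arr using D H_gam_coalgebra[OF cE] du d(1)
    by (simp del: V.mem_coalgebras conj_simps)
  then show "counit_hat M N H K \<eta> \<xi> C \<kappa> (Y, d) \<in>
      hom (coalg_cat N Cv) (H_gam_obj N H \<eta> C (K_gam_obj M C \<kappa> (Y, d))) (Y, d)"
    unfolding counit by (simp add: K_gam_obj_def k del: H_gam_simps V.mem_coalg_arr)
  have "equalizer N (amap H (pair1 Y)) (amap H (pair2 d)) (amap H e)"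
    using H_preserves[OF pair_coreflexive[OF D] pair_split_under[OF D]] eq
    by (simp add: preserves_equalizer_def)
  then have "iso N (coun Cv Y \<cdot>\<^bsub>N\<^esub> amap H e)"
    using d by (intro N.equalizer_retraction_iso[OF N.split_cofork_equalizer[OF pair_split_cofork[OF D]]])
      simp_all
  then have "iso N ?u"
    using d(1) by simp
  then show "iso (coalg_cat N Cv) (counit_hat M N H K \<eta> \<xi> C \<kappa> (Y, d))"
    unfolding counit H_gam_simps using u_arr[unfolded H_gam_simps] by (intro V.coalg_iso)
qed

text \<open>The definite description that gives the right adjoint on arrows denotes a factorization: \<open>T K g\<close>
  composed with the equalizer chosen at \<open>(Y, d)\<close> equalizes the pair at \<open>(Y', d')\<close>, because \<open>g\<close> is
  a coalgebra morphism.\<close>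

lemma K_gam_arr:
  assumes g: "((Y, d), g, (Y', d')) \<in> Arr (coalg_cat N Cv)"
  shows "amap (K_gam M K C \<kappa>) ((Y, d), g, (Y', d')) \<in>
      hom (coalg_cat M C) (K_gam_obj M C \<kappa> (Y, d)) (K_gam_obj M C \<kappa> (Y', d'))"
    and "und (\<kappa> (Y', d')) \<cdot>\<^bsub>M\<^esub> und (amap (K_gam M K C \<kappa>) ((Y, d), g, (Y', d'))) =
      amap T (amap K g) \<cdot>\<^bsub>M\<^esub> und (\<kappa> (Y, d))"
proof -
  have D: "(Y, d) \<in> coalgebras N Cv" and D': "(Y', d') \<in> coalgebras N Cv"
    and g' [simp]: "g \<in> Arr N" "Dom N g = Y" "Cod N g = Y'"
    and dg: "d' \<cdot>\<^bsub>N\<^esub> g = amap (endo Cv) g \<cdot>\<^bsub>N\<^esub> d"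
    using g unfolding V.mem_coalg_arr by blast+
  note d [simp] = conj_coalgebraD(1-4)[OF D] conj_coalgebraD(1-4)[OF D']
  obtain E c e where k: "\<kappa> (Y, d) = ((E, c), e, (omap T (omap K Y), \<delta> (omap K Y)))"
    and e: "((E, c), e, (omap T (omap K Y), \<delta> (omap K Y))) \<in> Arr (coalg_cat M C)"
    and eq: "equalizer M (pair1 Y) (pair2 d) e"
    using kappaE[OF D] .
  have e' [simp]: "e \<in> Arr M" "Cod M e = omap T (omap K Y)"
    using e by simp_all
  let ?g = "(cofree C (omap K Y), amap T (amap K g), cofree C (omap K Y'))"
  let ?h = "?g \<cdot>\<^bsub>coalg_cat M C\<^esub> \<kappa> (Y, d)"
  have h: "?h = ((E, c), amap T (amap K g) \<cdot>\<^bsub>M\<^esub> e, cofree C (omap K Y'))"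
    by (simp add: k)
  have "?g \<in> Arr (coalg_cat M C)"
    by (simp add: cofree_def coassoc eps_delta nat_rules)
  then have h_arr: "?h \<in> Arr (coalg_cat M C)"
    using e by (intro E.comp_arr(1)) (simp_all add: k cofree_def del: mem_coalg_arr)
  have "pair2 d' \<cdot>\<^bsub>M\<^esub> amap T (amap K g) = amap T (amap K (d' \<cdot>\<^bsub>N\<^esub> g))"
    by simp
  also have "\<dots> = amap T (amap K (amap (endo Cv) g)) \<cdot>\<^bsub>M\<^esub> pair2 d"
    unfolding dg by simp
  finally have "pair2 d' \<cdot>\<^bsub>M\<^esub> amap T (amap K g) \<cdot>\<^bsub>M\<^esub> e =
      amap T (amap K (amap (endo Cv) g)) \<cdot>\<^bsub>M\<^esub> pair2 d \<cdot>\<^bsub>M\<^esub> e"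
    by (rule comp_square) simp_all
  also have "\<dots> = pair1 Y' \<cdot>\<^bsub>M\<^esub> amap T (amap K g) \<cdot>\<^bsub>M\<^esub> e"
    unfolding equalizerD(7)[OF eq, symmetric] by (simp add: nat_rules)
  finally have "pair_fst M H K \<eta> C (Y', d') \<cdot>\<^bsub>coalg_cat M C\<^esub> ?h =
      pair_snd H K C (Y', d') \<cdot>\<^bsub>coalg_cat M C\<^esub> ?h"
    unfolding h pair_simps by simp
  then have "\<exists>!u. u \<in> hom (coalg_cat M C) (Dom (coalg_cat M C) ?h) (Dom (coalg_cat M C) (\<kappa> (Y', d'))) \<and>
      \<kappa> (Y', d') \<cdot>\<^bsub>coalg_cat M C\<^esub> u = ?h"
    using h_arr by (intro E.equalizer_factor_ex1[OF kappa_equalizer[OF D']])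
      (simp_all add: k pair_simps cofree_def del: mem_coalg_arr)
  then have u: "amap (K_gam M K C \<kappa>) ((Y, d), g, (Y', d')) \<in>
        hom (coalg_cat M C) (Dom (coalg_cat M C) ?h) (Dom (coalg_cat M C) (\<kappa> (Y', d'))) \<and>
      \<kappa> (Y', d') \<cdot>\<^bsub>coalg_cat M C\<^esub> amap (K_gam M K C \<kappa>) ((Y, d), g, (Y', d')) = ?h"
    using theI' by (simp add: K_gam_def K_gam_obj_def k)
  show "amap (K_gam M K C \<kappa>) ((Y, d), g, (Y', d')) \<in>
      hom (coalg_cat M C) (K_gam_obj M C \<kappa> (Y, d)) (K_gam_obj M C \<kappa> (Y', d'))"
    using conjunct1[OF u] by (simp add: K_gam_obj_def h k)
  have "und (\<kappa> (Y', d') \<cdot>\<^bsub>coalg_cat M C\<^esub> amap (K_gam M K C \<kappa>) ((Y, d), g, (Y', d'))) = und ?h"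
    using conjunct2[OF u] by simp
  then show "und (\<kappa> (Y', d')) \<cdot>\<^bsub>M\<^esub> und (amap (K_gam M K C \<kappa>) ((Y, d), g, (Y', d'))) =
      amap T (amap K g) \<cdot>\<^bsub>M\<^esub> und (\<kappa> (Y, d))"
    by (simp add: und_comp)
qed

text \<open>The arrow \<open>T (\<eta> X) \<circ> c\<close> equalizes the pair at the image of \<open>(X, c)\<close> by coassociativity of \<open>c\<close>
  and naturality of the unit of the adjunction.\<close>

lemma unit_arr:
  assumes S: "(X, c) \<in> coalgebras M C"
  shows "unit_hat M N H K \<eta> C \<kappa> (X, c) \<in>
      hom (coalg_cat M C) (X, c) (K_gam_obj M C \<kappa> (H_gam_obj N H \<eta> C (X, c)))"
    and "und (\<kappa> (H_gam_obj N H \<eta> C (X, c))) \<cdot>\<^bsub>M\<^esub> und (unit_hat M N H K \<eta> C \<kappa> (X, c)) =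
      amap T (\<eta> X) \<cdot>\<^bsub>M\<^esub> c"
proof -
  have c [simp]: "X \<in> Obj M" "c \<in> Arr M" "Dom M c = X" "Cod M c = omap T X"
    and cc: "\<delta> X \<cdot>\<^bsub>M\<^esub> c = amap T c \<cdot>\<^bsub>M\<^esub> c"
    using S by simp_all
  let ?d = "amap H (amap T (\<eta> X)) \<cdot>\<^bsub>N\<^esub> amap H c"
  let ?h = "((X, c), amap T (\<eta> X) \<cdot>\<^bsub>M\<^esub> c, cofree C (omap K (omap H X)))"
  note D = H_gam_coalgebra[OF S]
  have h_arr: "?h \<in> Arr (coalg_cat M C)"
    using S by (simp add: cofree_def coassoc eps_delta nat_rules)
  have "amap T (amap K (amap H c)) \<cdot>\<^bsub>M\<^esub> amap T (\<eta> X) \<cdot>\<^bsub>M\<^esub> c =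
      amap T (\<eta> (omap T X)) \<cdot>\<^bsub>M\<^esub> \<delta> X \<cdot>\<^bsub>M\<^esub> c"
    unfolding cc by (simp add: nat_rules)
  then have "pair1 (omap H X) \<cdot>\<^bsub>M\<^esub> amap T (\<eta> X) \<cdot>\<^bsub>M\<^esub> c = pair2 ?d \<cdot>\<^bsub>M\<^esub> amap T (\<eta> X) \<cdot>\<^bsub>M\<^esub> c"
    by (simp add: nat_rules)
  then have "pair_fst M H K \<eta> C (omap H X, ?d) \<cdot>\<^bsub>coalg_cat M C\<^esub> ?h =
      pair_snd H K C (omap H X, ?d) \<cdot>\<^bsub>coalg_cat M C\<^esub> ?h"
    unfolding pair_simps coalg_cat_simps by simp
  then have "\<exists>!u. u \<in> hom (coalg_cat M C) (Dom (coalg_cat M C) ?h)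
        (Dom (coalg_cat M C) (\<kappa> (omap H X, ?d))) \<and>
      \<kappa> (omap H X, ?d) \<cdot>\<^bsub>coalg_cat M C\<^esub> u = ?h"
    using h_arr by (intro E.equalizer_factor_ex1[OF kappa_equalizer[OF D]])
      (simp_all add: pair_simps cofree_def del: mem_coalg_arr)
  then have u: "unit_hat M N H K \<eta> C \<kappa> (X, c) \<in> hom (coalg_cat M C) (Dom (coalg_cat M C) ?h)
        (Dom (coalg_cat M C) (\<kappa> (omap H X, ?d))) \<and>
      \<kappa> (omap H X, ?d) \<cdot>\<^bsub>coalg_cat M C\<^esub> unit_hat M N H K \<eta> C \<kappa> (X, c) = ?h"
    using theI' by (simp add: unit_hat_def K_gam_obj_def)
  show "unit_hat M N H K \<eta> C \<kappa> (X, c) \<in>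
      hom (coalg_cat M C) (X, c) (K_gam_obj M C \<kappa> (H_gam_obj N H \<eta> C (X, c)))"
    using conjunct1[OF u] by (simp add: K_gam_obj_def)
  have "und (\<kappa> (omap H X, ?d) \<cdot>\<^bsub>coalg_cat M C\<^esub> unit_hat M N H K \<eta> C \<kappa> (X, c)) = und ?h"
    using conjunct2[OF u] by simp
  then show "und (\<kappa> (H_gam_obj N H \<eta> C (X, c))) \<cdot>\<^bsub>M\<^esub> und (unit_hat M N H K \<eta> C \<kappa> (X, c)) =
      amap T (\<eta> X) \<cdot>\<^bsub>M\<^esub> c"
    by (simp add: und_comp)
qed

text \<open>On underlying arrows this is
  \<open>\<xi> \<circ> H \<epsilon> \<circ> H (T \<eta>) \<circ> H c = \<xi> \<circ> H \<eta> \<circ> H (\<epsilon> \<circ> c)\<close>, which collapses by the triangle identity for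
  \<open>H\<close> and the counit law of \<open>c\<close>.\<close>

lemma lifted_triangle:
  assumes S: "(X, c) \<in> coalgebras M C"
  shows "counit_hat M N H K \<eta> \<xi> C \<kappa> (H_gam_obj N H \<eta> C (X, c)) \<cdot>\<^bsub>coalg_cat N Cv\<^esub>
      amap (H_gam N H \<eta> C) (unit_hat M N H K \<eta> C \<kappa> (X, c)) =
    Ident (coalg_cat N Cv) (H_gam_obj N H \<eta> C (X, c))"
proof -
  let ?d = "amap H (amap T (\<eta> X)) \<cdot>\<^bsub>N\<^esub> amap H c"
  have c [simp]: "X \<in> Obj M" "c \<in> Arr M" "Dom M c = X" "Cod M c = omap T X"
    and ec: "\<epsilon> X \<cdot>\<^bsub>M\<^esub> c = Ident M X"
    using S by simp_all
  note D = H_gam_coalgebra[OF S]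
  obtain E k e where k: "\<kappa> (omap H X, ?d) =
      ((E, k), e, (omap T (omap K (omap H X)), \<delta> (omap K (omap H X))))"
    and e: "((E, k), e, (omap T (omap K (omap H X)), \<delta> (omap K (omap H X)))) \<in> Arr (coalg_cat M C)"
    using kappaE[OF D] .
  obtain u where u: "unit_hat M N H K \<eta> C \<kappa> (X, c) = ((X, c), u, (E, k))"
    and u_arr: "((X, c), u, (E, k)) \<in> Arr (coalg_cat M C)"
    using unit_arr(1)[OF S] unfolding K_gam_obj_def H_gam_simps k coalg_cat_simps
    by (cases "unit_hat M N H K \<eta> C \<kappa> (X, c)") (simp del: mem_coalg_arr)
  have eu: "e \<cdot>\<^bsub>M\<^esub> u = amap T (\<eta> X) \<cdot>\<^bsub>M\<^esub> c"
    using unit_arr(2)[OF S] unfolding H_gam_simps k u by simp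
  have arrs [simp]: "e \<in> Arr M" "Dom M e = E" "Cod M e = omap T (omap K (omap H X))"
    "u \<in> Arr M" "Dom M u = X" "Cod M u = E"
    using e u_arr by simp_all
  have Heu: "amap H e \<cdot>\<^bsub>N\<^esub> amap H u = amap H (amap T (\<eta> X)) \<cdot>\<^bsub>N\<^esub> amap H c"
    by (rule functor_square[OF H_functor eu]) simp_all
  have "amap H (\<epsilon> X) \<cdot>\<^bsub>N\<^esub> amap H c = Ident N (omap H X)"
    by (rule functor_cancel[OF H_functor ec]) simp_all
  then have "(\<xi> (omap H X) \<cdot>\<^bsub>N\<^esub> amap H (\<epsilon> (omap K (omap H X))) \<cdot>\<^bsub>N\<^esub> amap H e) \<cdot>\<^bsub>N\<^esub> amap H u =
      Ident N (omap H X)"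
    by (simp add: Heu nat_rules cancel_rules)
  then show ?thesis
    unfolding u H_gam_simps by (simp add: counit_hat_def K_gam_obj_def k)
qed

lemma counit_natural:
  assumes g: "((Y, d), g, (Y', d')) \<in> Arr (coalg_cat N Cv)"
  shows "counit_hat M N H K \<eta> \<xi> C \<kappa> (Y', d') \<cdot>\<^bsub>coalg_cat N Cv\<^esub>
      amap (H_gam N H \<eta> C) (amap (K_gam M K C \<kappa>) ((Y, d), g, (Y', d'))) =
    ((Y, d), g, (Y', d')) \<cdot>\<^bsub>coalg_cat N Cv\<^esub> counit_hat M N H K \<eta> \<xi> C \<kappa> (Y, d)"
proof -
  have D: "(Y, d) \<in> coalgebras N Cv" and D': "(Y', d') \<in> coalgebras N Cv"
    and g' [simp]: "g \<in> Arr N" "Dom N g = Y" "Cod N g = Y'"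
    using g unfolding V.mem_coalg_arr by blast+
  note d [simp] = conj_coalgebraD(1-4)[OF D] conj_coalgebraD(1-4)[OF D']
  obtain E c e where k: "\<kappa> (Y, d) = ((E, c), e, (omap T (omap K Y), \<delta> (omap K Y)))"
    and e: "((E, c), e, (omap T (omap K Y), \<delta> (omap K Y))) \<in> Arr (coalg_cat M C)"
    using kappaE[OF D] .
  obtain E' c' e' where k': "\<kappa> (Y', d') = ((E', c'), e', (omap T (omap K Y'), \<delta> (omap K Y')))"
    and e': "((E', c'), e', (omap T (omap K Y'), \<delta> (omap K Y'))) \<in> Arr (coalg_cat M C)"
    using kappaE[OF D'] .
  obtain u where u: "amap (K_gam M K C \<kappa>) ((Y, d), g, (Y', d')) = ((E, c), u, (E', c'))"
    and u_arr: "((E, c), u, (E', c')) \<in> Arr (coalg_cat M C)"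
    using K_gam_arr(1)[OF g] unfolding K_gam_obj_def k k' coalg_cat_simps
    by (cases "amap (K_gam M K C \<kappa>) ((Y, d), g, (Y', d'))") (simp del: mem_coalg_arr)
  have eu: "e' \<cdot>\<^bsub>M\<^esub> u = amap T (amap K g) \<cdot>\<^bsub>M\<^esub> e"
    using K_gam_arr(2)[OF g] unfolding k k' u by simp
  have arrs [simp]: "e \<in> Arr M" "Dom M e = E" "Cod M e = omap T (omap K Y)"
    "e' \<in> Arr M" "Dom M e' = E'" "Cod M e' = omap T (omap K Y')"
    "u \<in> Arr M" "Dom M u = E" "Cod M u = E'"
    using e e' u_arr by simp_all
  have "amap H e' \<cdot>\<^bsub>N\<^esub> amap H u = amap H (amap T (amap K g)) \<cdot>\<^bsub>N\<^esub> amap H e"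
    by (rule functor_square[OF H_functor eu]) simp_all
  then have "(\<xi> Y' \<cdot>\<^bsub>N\<^esub> amap H (\<epsilon> (omap K Y')) \<cdot>\<^bsub>N\<^esub> amap H e') \<cdot>\<^bsub>N\<^esub> amap H u =
      g \<cdot>\<^bsub>N\<^esub> \<xi> Y \<cdot>\<^bsub>N\<^esub> amap H (\<epsilon> (omap K Y)) \<cdot>\<^bsub>N\<^esub> amap H e"
    by (simp add: nat_rules)
  then show ?thesis
    unfolding u by (simp add: counit_hat_def K_gam_obj_def k k')
qed

lemma unit_iso:
  assumes S: "(X, c) \<in> coalgebras M C"
  shows "iso (coalg_cat M C) (unit_hat M N H K \<eta> C \<kappa> (X, c))"
proof -
  let ?D = "(omap H X, amap H (amap T (\<eta> X)) \<cdot>\<^bsub>N\<^esub> amap H c)"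
  note D = H_gam_coalgebra[OF S]
  note u = unit_arr(1)[OF S, unfolded H_gam_simps mem_hom]
    and p = counit_arr_iso[OF D, unfolded mem_hom]
  have R: "omap (H_gam N H \<eta> C) (K_gam_obj M C \<kappa> ?D) = H_gam_obj N H \<eta> C (K_gam_obj M C \<kappa> ?D)"
    by (simp add: H_gam_def)
  show ?thesis
  proof (rule unit_iso_of_counit_iso[OF H_gam_functor H_gam_conservative[OF H_conservative] _ _ _ p(2)])
    show "counit_hat M N H K \<eta> \<xi> C \<kappa> ?D \<cdot>\<^bsub>coalg_cat N Cv\<^esub>
        amap (H_gam N H \<eta> C) (unit_hat M N H K \<eta> C \<kappa> (X, c)) =
      Ident (coalg_cat N Cv) (omap (H_gam N H \<eta> C) (X, c))"
      using lifted_triangle[OF S] by (simp only: H_gam_simps)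
  qed (use S u p R in \<open>simp_all only: H_gam_simps coalg_cat_simps\<close>)
qed

text \<open>If \<open>H f = H g\<close> then \<open>T (\<eta> Y) \<circ> d\<close> has the same composite with \<open>f\<close> and with \<open>g\<close>, by naturality of the unit. This arrow
  is the invertible lifted unit followed by an equalizer, hence monic.\<close>

lemma H_gam_faithful:
  assumes fg: "parallel (coalg_cat M C) f g" and eq: "amap (H_gam N H \<eta> C) f = amap (H_gam N H \<eta> C) g"
  shows "f = g"
proof -
  obtain X c f' Y d where f: "f = ((X, c), f', (Y, d))"
    by (metis prod.collapse)
  obtain g' where g: "g = ((X, c), g', (Y, d))"
    using fg unfolding parallel_def f by (metis coalg_cat_simps(2,3) prod.collapse)
  have arrs: "((X, c), f', (Y, d)) \<in> Arr (coalg_cat M C)" "((X, c), g', (Y, d)) \<in> Arr (coalg_cat M C)"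
    using fg unfolding parallel_def f g by blast+
  then have S: "(Y, d) \<in> coalgebras M C"
    unfolding mem_coalg_arr by blast
  have [simp]: "X \<in> Obj M" "c \<in> Arr M" "Dom M c = X" "Cod M c = omap T X"
    "Y \<in> Obj M" "d \<in> Arr M" "Dom M d = Y" "Cod M d = omap T Y"
    "f' \<in> Arr M" "Dom M f' = X" "Cod M f' = Y" "g' \<in> Arr M" "Dom M g' = X" "Cod M g' = Y"
    and df: "d \<cdot>\<^bsub>M\<^esub> f' = amap T f' \<cdot>\<^bsub>M\<^esub> c" and dg: "d \<cdot>\<^bsub>M\<^esub> g' = amap T g' \<cdot>\<^bsub>M\<^esub> c"
    using arrs by simp_all
  let ?v = "amap T (\<eta> Y) \<cdot>\<^bsub>M\<^esub> d"
  have "amap H f' = amap H g'"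
    using eq unfolding f g by simp
  then have "amap T (amap K (amap H f')) \<cdot>\<^bsub>M\<^esub> amap T (\<eta> X) \<cdot>\<^bsub>M\<^esub> c =
      amap T (amap K (amap H g')) \<cdot>\<^bsub>M\<^esub> amap T (\<eta> X) \<cdot>\<^bsub>M\<^esub> c"
    by simp
  then have v: "?v \<cdot>\<^bsub>M\<^esub> f' = ?v \<cdot>\<^bsub>M\<^esub> g'"
    by (simp add: nat_rules df dg)
  let ?D = "H_gam_obj N H \<eta> C (Y, d)"
  obtain E k e where k: "\<kappa> ?D = ((E, k), e, (omap T (omap K (omap H Y)), \<delta> (omap K (omap H Y))))"
    and e: "equalizer M (pair1 (omap H Y)) (pair2 (snd ?D)) e"
    and e_arr: "((E, k), e, (omap T (omap K (omap H Y)), \<delta> (omap K (omap H Y)))) \<in> Arr (coalg_cat M C)"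
    using kappaE[OF H_gam_coalgebra[OF S]] unfolding H_gam_simps snd_conv by blast
  obtain u where u: "unit_hat M N H K \<eta> C \<kappa> (Y, d) = ((Y, d), u, (E, k))"
    using unit_arr(1)[OF S] unfolding K_gam_obj_def k coalg_cat_simps
    by (cases "unit_hat M N H K \<eta> C \<kappa> (Y, d)") (simp del: mem_coalg_arr)
  have i: "iso M u"
    using unit_iso[OF S] unfolding u by (rule iso_und)
  have [simp]: "u \<in> Arr M" "Dom M u = Y" "Cod M u = E"
    using unit_arr(1)[OF S] unfolding u by (simp_all add: K_gam_obj_def)
  have [simp]: "e \<in> Arr M" "Dom M e = E"
    using e_arr by simp_all
  have "e \<cdot>\<^bsub>M\<^esub> u = ?v"
    using unit_arr(2)[OF S] unfolding k u by simp
  then have "e \<cdot>\<^bsub>M\<^esub> u \<cdot>\<^bsub>M\<^esub> f' = e \<cdot>\<^bsub>M\<^esub> u \<cdot>\<^bsub>M\<^esub> g'"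
    using v comp_assoc[of f' u e] comp_assoc[of g' u e] by simp
  then have "u \<cdot>\<^bsub>M\<^esub> f' = u \<cdot>\<^bsub>M\<^esub> g'"
    by - (rule equalizer_monic[OF e], simp_all)
  then have "f' = g'"
    by - (rule iso_cancel_left[OF i], simp_all)
  then show ?thesis
    by (simp add: f g)
qed

lemma lifted_adjoint_equivalence:
  "adjoint_equivalence (coalg_cat M C) (coalg_cat N Cv) (H_gam N H \<eta> C) (K_gam M K C \<kappa>)
    (unit_hat M N H K \<eta> C \<kappa>) (counit_hat M N H K \<eta> \<xi> C \<kappa>)"
proof (rule adjoint_equivalenceI[OF H_gam_functor H_gam_conservative[OF H_conservative]])
  have obj: "omap (K_gam M K C \<kappa>) D = K_gam_obj M C \<kappa> D"
    "omap (H_gam N H \<eta> C) S = H_gam_obj N H \<eta> C S" for D S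
    by (simp_all add: K_gam_def H_gam_def)
  show "f = g" if "parallel (coalg_cat M C) f g" "amap (H_gam N H \<eta> C) f = amap (H_gam N H \<eta> C) g" for f g
    using H_gam_faithful that .
  {
    fix D assume "D \<in> Obj (coalg_cat N Cv)"
    then obtain Y d where D: "D = (Y, d)" "(Y, d) \<in> coalgebras N Cv"
      unfolding V.coalg_cat_simps by (metis prod.collapse)
    show "omap (K_gam M K C \<kappa>) D \<in> Obj (coalg_cat M C)"
      unfolding obj K_gam_obj_def D(1) using E.equalizerD(5)[OF kappa_equalizer[OF D(2)]] by (rule E.Dom_Obj)
    show "counit_hat M N H K \<eta> \<xi> C \<kappa> D \<in>
        hom (coalg_cat N Cv) (omap (H_gam N H \<eta> C) (omap (K_gam M K C \<kappa>) D)) D"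
      unfolding obj D(1) by (rule counit_arr_iso(1)[OF D(2)])
    show "iso (coalg_cat N Cv) (counit_hat M N H K \<eta> \<xi> C \<kappa> D)"
      unfolding D(1) by (rule counit_arr_iso(2)[OF D(2)])
  }
  {
    fix a assume a: "a \<in> Arr (coalg_cat N Cv)"
    obtain Y d g Y' d' where a': "a = ((Y, d), g, (Y', d'))"
      by (metis prod.collapse)
    note g = a[unfolded a']
    show "amap (K_gam M K C \<kappa>) a \<in> hom (coalg_cat M C)
        (omap (K_gam M K C \<kappa>) (Dom (coalg_cat N Cv) a)) (omap (K_gam M K C \<kappa>) (Cod (coalg_cat N Cv) a))"
      unfolding obj a' V.coalg_cat_simps by (rule K_gam_arr(1)[OF g])
    show "counit_hat M N H K \<eta> \<xi> C \<kappa> (Cod (coalg_cat N Cv) a) \<cdot>\<^bsub>coalg_cat N Cv\<^esub>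
        amap (H_gam N H \<eta> C) (amap (K_gam M K C \<kappa>) a) =
      a \<cdot>\<^bsub>coalg_cat N Cv\<^esub> counit_hat M N H K \<eta> \<xi> C \<kappa> (Dom (coalg_cat N Cv) a)"
      unfolding a' V.coalg_cat_simps(2,3) by (rule counit_natural[OF g])
  }
  {
    fix S assume "S \<in> Obj (coalg_cat M C)"
    then obtain X c where S: "S = (X, c)" "(X, c) \<in> coalgebras M C"
      unfolding coalg_cat_simps by (metis prod.collapse)
    show "unit_hat M N H K \<eta> C \<kappa> S \<in>
        hom (coalg_cat M C) S (omap (K_gam M K C \<kappa>) (omap (H_gam N H \<eta> C) S))"
      unfolding obj S(1) by (rule unit_arr(1)[OF S(2)])
    show "counit_hat M N H K \<eta> \<xi> C \<kappa> (omap (H_gam N H \<eta> C) S) \<cdot>\<^bsub>coalg_cat N Cv\<^esub>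
        amap (H_gam N H \<eta> C) (unit_hat M N H K \<eta> C \<kappa> S) =
      Ident (coalg_cat N Cv) (omap (H_gam N H \<eta> C) S)"
      unfolding obj S(1) by (rule lifted_triangle[OF S(2)])
  }
qed

end

end

theorem corollary2p10:
  fixes M :: "('m, 'f) cat" and N :: "('n, 'g) cat"
    and H :: "('m, 'f, 'n, 'g) ftor" and K :: "('n, 'g, 'm, 'f) ftor"
    and \<eta> :: "'m \<Rightarrow> 'f" and \<xi> :: "'n \<Rightarrow> 'g"
    and C :: "('m, 'f) comonad_data"
  assumes "category M" and "category N"
    and "adjunction M N H K \<eta> \<xi>"
    and "comonad M C"
    and a: "\<And>f g. coreflexive M f g \<Longrightarrow> split_under M N H f g \<Longrightarrow> \<exists>e. equalizer M f g e"
    and b: "\<And>f g. coreflexive M f g \<Longrightarrow> split_under M N H f g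
              \<Longrightarrow> preserves_equalizer M N H f g"
    and c: "conservative M N H"
    and d: "\<And>f g. coreflexive M f g \<Longrightarrow> split_under M N H f g
              \<Longrightarrow> preserves_equalizer M M (endo C) f g
                  \<and> preserves_equalizer M M (endo C \<circ>\<^sub>F endo C) f g"
  shows "(\<exists>\<kappa>. equalizer_choice M N H K \<eta> \<xi> C \<kappa>) \<and>
    (\<forall>\<kappa>. equalizer_choice M N H K \<eta> \<xi> C \<kappa> \<longrightarrow>
       adjoint_equivalence (coalg_cat M C) (coalg_cat N (conj_comonad N H K \<eta> \<xi> C))
         (H_gam N H \<eta> C) (K_gam M K C \<kappa>)
         (unit_hat M N H K \<eta> C \<kappa>) (counit_hat M N H K \<eta> \<xi> C \<kappa>))"
proof -
  interpret beck_conditions M C N H K \<eta> \<xi>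
    using assms by unfold_locales
  show ?thesis
    using equalizer_choice_exists lifted_adjoint_equivalence by blast
qed

end
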